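(* There is a randomized algorithm which, given a discounted Markov decision process $(S,A,P,r,\gamma)$ with rewards in $[-M,M]$ accessed through the sampling oracle described below (and the rewards), a target accuracy $\epsilon>0$ and a failure probability $\delta\in(0,1)$, with probability at least $1-\delta$ computes an $\epsilon$-optimal policy in time \[ \tilde O\left(\frac{|S||A|M^2}{(1-\gamma)^4\epsilon^2}\log\left(\frac1\delta\right)\right). \]
   Context: A discounted Markov decision process (DMDP) is a tuple $(S,A,P,r,\gamma)$: $S$ is a finite set of states, $A$ a finite set of actions, for each $i\in S$, $a\in A$ the vector $p_a(i)\in\mathbb{R}^S$ is a probability distribution ($p_a(i,j)$ is the probability of moving to state $j$ from state $i$ when taking action $a$), $r_a(i)\in[-M,M]$ is the reward for taking action $a$ at state $i$ ($M>0$ known), and $\gamma\in(0,1)$ is the discount factor. Sampling oracle: for any $i\in S$, $a\in A$ one can draw an independent sample $j\in S$ with $\Pr[j=k]=p_a(i,k)$ in expected $O(1)$ time. The value operator $T:\mathbb{R}^S\to\mathbb{R}^S$ is $T(u)_i=\max_{a\in A}[r_a(i)+\gamma\, p_a(i)^\top u]$, and $v^*$ is its unique fixed point. A policy is a vector $\pi\in A^S$; its operator is $T_\pi(u)_i=r_{\pi_i}(i)+\gamma\,p_{\pi_i}(i)^\top u$ and its value $v_\pi$ is the unique fixed point of $T_\pi$. A policy $\pi$ is $\epsilon$-optimal if $\|v^*-v_\pi\|_\infty\le\epsilon$. $\tilde O(\cdot)$ hides polylogarithmic factors in the input parameters.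
   Formalization: The bound has |S| added and log(1/δ) replaced by max(1, log(1/δ)), as the displayed one tends to 0 when ε→∞ or δ→1; operations, with a sample counted as one, are bounded with probability 1-δ, and total time including that of the sampling oracle is bounded in expectation. *)

theory Defs
  imports "HOL-Probability.Probability" "HOL-Probability.SPMF"
begin

section \<open>Discounted Markov decision processes\<close>

text \<open>States and actions are numbered: \<open>S = {..<nS}\<close> and \<open>A = {..<nA}\<close>.
  The row \<open>p\<^sub>a(i)\<close> is the probability mass function \<open>trans D i a\<close>.\<close>

record dmdp =
  nS :: nat
  nA :: nat
  trans :: "nat \<Rightarrow> nat \<Rightarrow> nat pmf"
  rew :: "nat \<Rightarrow> nat \<Rightarrow> real"
  disc :: real

definition is_dmdp :: "dmdp \<Rightarrow> real \<Rightarrow> bool" where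
  "is_dmdp D M \<longleftrightarrow> nS D > 0 \<and> nA D > 0 \<and> M > 0 \<and> 0 < disc D \<and> disc D < 1 \<and>
     (\<forall>i<nS D. \<forall>a<nA D. set_pmf (trans D i a) \<subseteq> {..<nS D} \<and> rew D i a \<in> {-M..M})"

text \<open>A vector in \<open>\<real>\<^sup>S\<close> is a function on \<open>nat\<close> that vanishes outside \<open>{..<nS}\<close>. Both operators
  return such functions, so their fixed points are unique as functions on \<open>nat\<close>.\<close>

definition action_value :: "dmdp \<Rightarrow> (nat \<Rightarrow> real) \<Rightarrow> nat \<Rightarrow> nat \<Rightarrow> real" where
  "action_value D u i a = rew D i a + disc D * (\<Sum>j<nS D. pmf (trans D i a) j * u j)"

definition value_op :: "dmdp \<Rightarrow> (nat \<Rightarrow> real) \<Rightarrow> nat \<Rightarrow> real" where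
  "value_op D u i = (if i < nS D then Max ((\<lambda>a. action_value D u i a) ` {..<nA D}) else 0)"

definition policy_op :: "dmdp \<Rightarrow> (nat \<Rightarrow> nat) \<Rightarrow> (nat \<Rightarrow> real) \<Rightarrow> nat \<Rightarrow> real" where
  "policy_op D \<pi> u i = (if i < nS D then action_value D u i (\<pi> i) else 0)"

definition opt_value :: "dmdp \<Rightarrow> nat \<Rightarrow> real" where
  "opt_value D = (THE v. value_op D v = v)"

definition policy_value :: "dmdp \<Rightarrow> (nat \<Rightarrow> nat) \<Rightarrow> nat \<Rightarrow> real" where
  "policy_value D \<pi> = (THE v. policy_op D \<pi> v = v)"

definition is_policy :: "dmdp \<Rightarrow> (nat \<Rightarrow> nat) \<Rightarrow> bool" where
  "is_policy D \<pi> \<longleftrightarrow> (\<forall>i<nS D. \<pi> i < nA D)"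

definition sup_norm :: "dmdp \<Rightarrow> (nat \<Rightarrow> real) \<Rightarrow> real" where
  "sup_norm D u = Max ((\<lambda>i. \<bar>u i\<bar>) ` {..<nS D})"

definition eps_optimal :: "dmdp \<Rightarrow> real \<Rightarrow> (nat \<Rightarrow> nat) \<Rightarrow> bool" where
  "eps_optimal D \<epsilon> \<pi> \<longleftrightarrow>
     is_policy D \<pi> \<and> sup_norm D (\<lambda>i. opt_value D i - policy_value D \<pi> i) \<le> \<epsilon>"


section \<open>The sampling oracle\<close>

text \<open>A query \<open>(i, a)\<close> returns the sampled next state together with the time the query took.
  That time is random, may depend on the query and on the sample, and has expectation at most
  the constant \<open>\<kappa>\<close>. Nothing is assumed about queries outside \<open>S \<times> A\<close>.\<close>

type_synonym sampler = "nat \<Rightarrow> nat \<Rightarrow> (nat \<times> nat) pmf"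

definition sampling_oracle :: "dmdp \<Rightarrow> real \<Rightarrow> sampler \<Rightarrow> bool" where
  "sampling_oracle D \<kappa> orc \<longleftrightarrow> (\<forall>i<nS D. \<forall>a<nA D.
     map_pmf fst (orc i a) = trans D i a \<and>
     (\<integral>\<^sup>+ x. of_nat (snd x) \<partial>measure_pmf (orc i a)) \<le> ennreal \<kappa>)"


section \<open>A randomized real RAM\<close>

text \<open>Algorithms are programs of a while language over a memory of integer cells and a memory of
  real cells; a cell is addressed by an array name and two indices, and scalars are the cells
  with indices \<open>(0, 0)\<close>. Every operation on integers and reals costs one unit of time. There is no
  rounding from reals to integers, no integer multiplication, and the only literals are
  natural numbers. Real division by zero yields zero.\<close>

type_synonym vname = string

datatype iexp =
    ILit nat
  | IGet vname iexp iexp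
  | IAdd iexp iexp
  | ISub iexp iexp

datatype rexp =
    OfNat iexp
  | RGet vname iexp iexp
  | RAdd rexp rexp
  | RSub rexp rexp
  | RMul rexp rexp
  | RDiv rexp rexp

datatype bexp =
    ILess iexp iexp
  | RLess rexp rexp
  | BNot bexp
  | BAnd bexp bexp

text \<open>\<open>Flip x\<close> stores a fair random bit in the scalar \<open>x\<close>, and \<open>Sample x i a\<close> stores
  there the state returned by the oracle on the query \<open>(i, a)\<close>.\<close>

datatype com =
    Skip
  | ISet vname iexp iexp iexp
  | RSet vname iexp iexp rexp
  | Flip vname
  | Sample vname iexp iexp
  | Seq com com
  | Cond bexp com com
  | While bexp com

text \<open>The two clocks cannot be read by programs: \<open>steps\<close> counts elementary operations, an oracle
  call being one of them, and \<open>orc_time\<close> accumulates the time spent inside the oracle.\<close>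

record state =
  imem :: "vname \<Rightarrow> nat \<Rightarrow> nat \<Rightarrow> nat"
  rmem :: "vname \<Rightarrow> nat \<Rightarrow> nat \<Rightarrow> real"
  steps :: nat
  orc_time :: nat

primrec ival :: "iexp \<Rightarrow> state \<Rightarrow> nat" where
  "ival (ILit n) s = n"
| "ival (IGet x e f) s = imem s x (ival e s) (ival f s)"
| "ival (IAdd e f) s = ival e s + ival f s"
| "ival (ISub e f) s = ival e s - ival f s"

primrec rval :: "rexp \<Rightarrow> state \<Rightarrow> real" where
  "rval (OfNat e) s = real (ival e s)"
| "rval (RGet x e f) s = rmem s x (ival e s) (ival f s)"
| "rval (RAdd e f) s = rval e s + rval f s"
| "rval (RSub e f) s = rval e s - rval f s"
| "rval (RMul e f) s = rval e s * rval f s"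
| "rval (RDiv e f) s = rval e s / rval f s"

primrec bval :: "bexp \<Rightarrow> state \<Rightarrow> bool" where
  "bval (ILess e f) s \<longleftrightarrow> ival e s < ival f s"
| "bval (RLess e f) s \<longleftrightarrow> rval e s < rval f s"
| "bval (BNot b) s \<longleftrightarrow> \<not> bval b s"
| "bval (BAnd b c) s \<longleftrightarrow> bval b s \<and> bval c s"

primrec icost :: "iexp \<Rightarrow> nat" where
  "icost (ILit n) = 1"
| "icost (IGet x e f) = 1 + icost e + icost f"
| "icost (IAdd e f) = 1 + icost e + icost f"
| "icost (ISub e f) = 1 + icost e + icost f"

primrec rcost :: "rexp \<Rightarrow> nat" where
  "rcost (OfNat e) = 1 + icost e"
| "rcost (RGet x e f) = 1 + icost e + icost f"
| "rcost (RAdd e f) = 1 + rcost e + rcost f"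
| "rcost (RSub e f) = 1 + rcost e + rcost f"
| "rcost (RMul e f) = 1 + rcost e + rcost f"
| "rcost (RDiv e f) = 1 + rcost e + rcost f"

primrec bcost :: "bexp \<Rightarrow> nat" where
  "bcost (ILess e f) = 1 + icost e + icost f"
| "bcost (RLess e f) = 1 + rcost e + rcost f"
| "bcost (BNot b) = 1 + bcost b"
| "bcost (BAnd b c) = 1 + bcost b + bcost c"

definition tick :: "nat \<Rightarrow> state \<Rightarrow> state" where
  "tick n s = s\<lparr>steps := steps s + n\<rparr>"

definition iput :: "vname \<Rightarrow> nat \<Rightarrow> nat \<Rightarrow> nat \<Rightarrow> state \<Rightarrow> state" where
  "iput x m n z s = s\<lparr>imem := (imem s)(x := (imem s x)(m := (imem s x m)(n := z)))\<rparr>"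

definition rput :: "vname \<Rightarrow> nat \<Rightarrow> nat \<Rightarrow> real \<Rightarrow> state \<Rightarrow> state" where
  "rput x m n z s = s\<lparr>rmem := (rmem s)(x := (rmem s x)(m := (rmem s x m)(n := z)))\<rparr>"

partial_function (spmf) loop ::
  "('s \<Rightarrow> bool) \<Rightarrow> ('s \<Rightarrow> 's spmf) \<Rightarrow> 's \<Rightarrow> 's spmf" where
  "loop b f s = (if b s then bind_spmf (f s) (loop b f) else return_spmf s)"

text \<open>The final state is a subdistribution: the missing mass is the probability of
  nontermination. Each oracle call draws afresh, so the samples are independent. Each
  evaluation of a loop guard is charged, including the last one.\<close>

primrec exec :: "sampler \<Rightarrow> com \<Rightarrow> state \<Rightarrow> state spmf" where
  "exec orc Skip s = return_spmf (tick 1 s)"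
| "exec orc (ISet x e f g) s =
     return_spmf (tick (1 + icost e + icost f + icost g)
       (iput x (ival e s) (ival f s) (ival g s) s))"
| "exec orc (RSet x e f g) s =
     return_spmf (tick (1 + icost e + icost f + rcost g)
       (rput x (ival e s) (ival f s) (rval g s) s))"
| "exec orc (Flip x) s =
     map_spmf (\<lambda>b. tick 1 (iput x 0 0 (of_bool b) s)) coin_spmf"
| "exec orc (Sample x e f) s =
     map_spmf (\<lambda>(j, t). tick (1 + icost e + icost f)
       ((iput x 0 0 j s)\<lparr>orc_time := orc_time s + t\<rparr>))
       (spmf_of_pmf (orc (ival e s) (ival f s)))"
| "exec orc (Seq c d) s = bind_spmf (exec orc c s) (exec orc d)"
| "exec orc (Cond b c d) s =
     (if bval b s then exec orc c (tick (1 + bcost b) s) else exec orc d (tick (1 + bcost b) s))"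
| "exec orc (While b c) s =
     map_spmf (tick (1 + bcost b))
       (loop (bval b) (\<lambda>t. exec orc c (tick (1 + bcost b) t)) s)"

text \<open>The input consists of \<open>|S|\<close>, \<open>|A|\<close>, \<open>M\<close>, \<open>\<gamma>\<close>, \<open>\<epsilon>\<close>, \<open>\<delta>\<close> and the rewards. The transition
  probabilities are not part of it. All other cells are zero.\<close>

definition init_state :: "dmdp \<Rightarrow> real \<Rightarrow> real \<Rightarrow> real \<Rightarrow> state" where
  "init_state D M \<epsilon> \<delta> =
    \<lparr>imem = (\<lambda>x i j. if i = 0 \<and> j = 0 \<and> x = ''S'' then nS D
               else if i = 0 \<and> j = 0 \<and> x = ''A'' then nA D
               else 0),
     rmem = (\<lambda>x i j. if i = 0 \<and> j = 0 \<and> x = ''M'' then M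
               else if i = 0 \<and> j = 0 \<and> x = ''gamma'' then disc D
               else if i = 0 \<and> j = 0 \<and> x = ''eps'' then \<epsilon>
               else if i = 0 \<and> j = 0 \<and> x = ''delta'' then \<delta>
               else if i < nS D \<and> j < nA D \<and> x = ''r'' then rew D i j
               else 0),
     steps = 0, orc_time = 0\<rparr>"

definition output_policy :: "state \<Rightarrow> nat \<Rightarrow> nat" where
  "output_policy s i = imem s ''pi'' i 0"

text \<open>Expected running time including the time spent in the oracle; a positive probability of
  nontermination makes it infinite.\<close>

definition expected_time :: "state spmf \<Rightarrow> ennreal" where
  "expected_time R =
     (\<integral>\<^sup>+ x. (case x of None \<Rightarrow> \<infinity> | Some s \<Rightarrow> of_nat (steps s + orc_time s)) \<partial>measure_pmf R)"


section \<open>The time bound\<close>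

text \<open>The main term is \<open>|S||A|M\<^sup>2 log(1/\<delta>) / ((1-\<gamma>)\<^sup>4 \<epsilon>\<^sup>2)\<close>. Two degenerate regimes need a
  convention. The factor \<open>log(1/\<delta>)\<close> vanishes as \<open>\<delta>\<close> tends to 1, so it is replaced by 1
  for \<open>\<delta> > 1/e\<close>. The main term vanishes as \<open>\<epsilon>\<close> tends to infinity, so the time \<open>|S|\<close> for writing the output
  is added; for \<open>\<epsilon> < 2M/(1-\<gamma>)\<close>, that is, unless all policies are trivially
  \<open>\<epsilon>\<close>-optimal, the main term already dominates \<open>|S|/4\<close>.\<close>

definition main_bound :: "dmdp \<Rightarrow> real \<Rightarrow> real \<Rightarrow> real \<Rightarrow> real" where
  "main_bound D M \<epsilon> \<delta> = real (nS D) +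
     real (nS D) * real (nA D) * M\<^sup>2 / ((1 - disc D) ^ 4 * \<epsilon>\<^sup>2) * max 1 (ln (1 / \<delta>))"

text \<open>The factors hidden by soft-O are powers of this logarithm; \<open>\<delta>\<close> does not occur in it
  because the dependence on \<open>\<delta>\<close> is explicit in the main term.\<close>

definition log_input :: "dmdp \<Rightarrow> real \<Rightarrow> real \<Rightarrow> real" where
  "log_input D M \<epsilon> = ln (2 + real (nS D) + real (nA D) + M + 1 / (1 - disc D) + 1 / \<epsilon>)"

end

(* Sampled value iteration with fresh samples, kept below the optimal value. The estimate of
   p^T v is the mean of x - eta/2 (x - y)^2 over independent pairs of samples, minus a constant
   beta: it has expectation p^T v - eta Var(v) - beta, and exponential moments at scale eta/3 put
   it between p^T v - 2 eta Var(v) - 2 beta and p^T v with high probability. Hence the iterates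
   satisfy v <= T_pi v for the current policy pi, so v <= v_pi and no accuracy is lost in passing
   from values to policies.
   With H = 1/(1-gamma), the error w against the constant upper bound HM obeys
   w_k <= c + gamma (P w_{k-1} + 2 eta Var(w_{k-1}) + 2 beta). Along the optimal policy the potential
   w + 4 eta w^2 absorbs the variances, since
   gamma Var(w_{k-1}) <= gamma P w_{k-1}^2 - w_k^2 + O(HM) (w_k - gamma P w_{k-1})^+.
   So eta ~ eps/(HM)^2 and beta ~ eps/H suffice, that is ~ H^3 M^2 / eps^2 samples per backup,
   and ~ H sweeps give the total H^4 M^2 / eps^2 without variance reduction and for all eps < 2HM. *)

theory Submission
  imports Defs
begin

section \<open>Bellman operators\<close>

text \<open>A confidence bound of Bernstein type involves the square root of an unknown variance.
  Subtracting \<eta> Var beforehand replaces it by a term linear in the variance: at scale \<eta>/3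
  the second-order term of the exponential moment is at most the penalty itself. So the variance
  need not be known, and the loss has the linear form that the potential argument can absorb. A
  second obstacle is adaptivity: the vector being averaged depends on all earlier samples, and the
  time of a query may depend on its answer. Backward reasoning with preexpectations handles both.
  While one estimate runs, the vector is constant, so the moment bounds apply conditionally on the
  past; and one weighted sum of failure charge and oracle time is propagated through the program.
  Oracle time must be bounded on failed runs as well, so accuracy of the estimates is never assumed
  where time is counted. The number of steps is bounded on every run.\<close>

lemma exists_fixpoint_of_sup_contraction:
  fixes T :: "(nat \<Rightarrow> real) \<Rightarrow> nat \<Rightarrow> real"
  assumes c: "0 \<le> c" "c < 1"
    and zero: "\<And>u i. \<not> i < n \<Longrightarrow> T u i = 0"
    and contr: "\<And>u v d i. i < n \<Longrightarrow> (\<And>j. j < n \<Longrightarrow> \<bar>u j - v j\<bar> \<le> d) \<Longrightarrow> \<bar>T u i - T v i\<bar> \<le> c * d"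
  shows "\<exists>u. T u = u"
proof -
  \<comment> \<open>\<open>banach_fix_type\<close> asks for a complete metric type. On
    \<open>nat discrete\<close> every function is continuous, so the bounded functions form one;
    \<open>T u\<close> is bounded because it vanishes outside a finite set.\<close>
  define E :: "(nat discrete \<Rightarrow>\<^sub>C real) \<Rightarrow> nat \<Rightarrow> real" where
    "E g i = apply_bcontfun g (discrete i)" for g i
  have bc: "(\<lambda>x. T u (of_discrete x)) \<in> bcontfun" for u
  proof (rule bcontfun_normI)
    show "continuous_on UNIV (\<lambda>x. T u (of_discrete x))"
      by (metis continuous_on_open_vimage open_UNIV open_discrete)
    show "norm (T u (of_discrete x)) \<le> (\<Sum>i<n. \<bar>T u i\<bar>)" for x
    proof (cases "of_discrete x < n")
      case True
      then show ?thesis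
        using member_le_sum[of "of_discrete x" "{..<n}" "\<lambda>i. \<bar>T u i\<bar>"] by simp
    next
      case False
      then show ?thesis by (simp add: zero sum_nonneg)
    qed
  qed
  define F where "F g = Bcontfun (\<lambda>x. T (E g) (of_discrete x))" for g
  have F: "apply_bcontfun (F g) x = T (E g) (of_discrete x)" for g x
    unfolding F_def by (simp add: Bcontfun_inverse bc)
  have "dist (F g) (F h) \<le> c * dist g h" for g h
  proof (rule dist_bound)
    fix x
    have "\<bar>E g j - E h j\<bar> \<le> dist g h" for j
      using dist_bounded[of g "discrete j" h] by (simp add: dist_real_def E_def)
    then show "dist (F g x) (F h x) \<le> c * dist g h"
      using contr[of "of_discrete x" "E g" "E h" "dist g h"] zero[of "of_discrete x"] c
      by (cases "of_discrete x < n") (simp_all add: F dist_real_def)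
  qed
  then have "\<exists>!g. F g = g"
    using banach_fix_type[of c F] c by blast
  then obtain g where "F g = g" by blast
  then have "T (E g) i = E g i" for i
    using F[of g "discrete i"] by (simp add: E_def discrete_inverse)
  then show ?thesis by blast
qed

section \<open>Transition averages, the horizon and the value range\<close>

locale discounted_mdp =
  fixes D :: dmdp and M :: real
  assumes is_dmdp: "is_dmdp D M"
begin

abbreviation "\<gamma> \<equiv> disc D"

definition mean :: "nat \<Rightarrow> nat \<Rightarrow> (nat \<Rightarrow> real) \<Rightarrow> real" where
  "mean i a u = (\<Sum>j<nS D. pmf (trans D i a) j * u j)"

definition H :: real where "H = 1 / (1 - \<gamma>)"

text \<open>Length of the interval from -H M to H M that contains all values. The shifted vectors
  \<open>V = v + H * M\<close> kept by the program range from 0 to \<open>R\<close>.\<close>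

definition R :: real where "R = 2 * H * M"

lemma nS_pos: "nS D > 0" and nA_pos: "nA D > 0" and M_pos: "M > 0"
  and disc_pos: "0 < \<gamma>" and disc_less: "\<gamma> < 1"
  using is_dmdp by (auto simp: is_dmdp_def)

lemma rew_bounds: "i < nS D \<Longrightarrow> a < nA D \<Longrightarrow> -M \<le> rew D i a \<and> rew D i a \<le> M"
  using is_dmdp by (auto simp: is_dmdp_def)

lemma set_trans: "i < nS D \<Longrightarrow> a < nA D \<Longrightarrow> set_pmf (trans D i a) \<subseteq> {..<nS D}"
  using is_dmdp by (auto simp: is_dmdp_def)

lemma H_ge_1: "1 \<le> H" and H_pos: "0 < H" and H_eq: "(1 - \<gamma>) * H = 1"
  using disc_pos disc_less by (auto simp: H_def field_simps)

lemma R_pos: "0 < R"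
  using H_pos M_pos by (simp add: R_def)

lemma R_eq: "(1 - \<gamma>) * R = 2 * M"
  using arg_cong[OF H_eq, of "\<lambda>x. 2 * M * x"] by (simp add: R_def mult_ac)

lemma R_disc: "\<gamma> * R = R - 2 * M"
  using R_eq by (simp add: algebra_simps)

lemma sum_trans: "i < nS D \<Longrightarrow> a < nA D \<Longrightarrow> (\<Sum>j<nS D. pmf (trans D i a) j) = 1"
  by (rule sum_pmf_eq_1) (auto simp: set_trans)

lemma mean_mono: "(\<And>j. j < nS D \<Longrightarrow> u j \<le> v j) \<Longrightarrow> mean i a u \<le> mean i a v"
  unfolding mean_def by (rule sum_mono) (auto intro: mult_left_mono)

lemma mean_const [simp]: "i < nS D \<Longrightarrow> a < nA D \<Longrightarrow> mean i a (\<lambda>_. c) = c"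
  unfolding mean_def by (simp add: sum_trans flip: sum_distrib_right)

lemma mean_add: "mean i a (\<lambda>j. u j + v j) = mean i a u + mean i a v"
  and mean_diff: "mean i a (\<lambda>j. u j - v j) = mean i a u - mean i a v"
  and mean_cmult: "mean i a (\<lambda>j. c * u j) = c * mean i a u"
  unfolding mean_def by (simp_all add: algebra_simps sum.distrib sum_subtractf sum_distrib_left)

lemma mean_bounds:
  assumes "i < nS D" "a < nA D" "\<And>j. j < nS D \<Longrightarrow> l \<le> u j \<and> u j \<le> h"
  shows "l \<le> mean i a u" "mean i a u \<le> h"
  using mean_mono[of "\<lambda>_. l" u i a] mean_mono[of u "\<lambda>_. h" i a] assms by simp_all

lemma action_value_mean: "action_value D u i a = rew D i a + \<gamma> * mean i a u"
  by (simp add: action_value_def mean_def)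

text \<open>At a state where \<open>d\<close> is maximal its average over successors is no larger,
  so (1 - \<gamma>) max d <= e. The action may differ from state to state, so the lemma serves for a
  policy as well as for maximizing actions; \<open>e = 0\<close> gives comparison and
  uniqueness.\<close>

lemma max_principle:
  assumes act: "\<And>i. i < nS D \<Longrightarrow> \<exists>a<nA D. d i \<le> \<gamma> * mean i a d + e"
    and i: "i < nS D"
  shows "d i \<le> H * e"
proof -
  define m where "m = Max (d ` {..<nS D})"
  have ne: "finite (d ` {..<nS D})" "d ` {..<nS D} \<noteq> {}"
    using nS_pos by auto
  have le: "d j \<le> m" if "j < nS D" for j
    unfolding m_def using that ne by (intro Max_ge) auto
  obtain j where j: "j < nS D" "d j = m"
    using Max_in[OF ne] unfolding m_def by auto
  obtain a where a: "a < nA D" "d j \<le> \<gamma> * mean j a d + e"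
    using act j by blast
  have "mean j a d \<le> m"
    using mean_mono[of d "\<lambda>_. m" j a] le a j by simp
  then have "\<gamma> * mean j a d \<le> \<gamma> * m"
    using disc_pos by simp
  then have "(1 - \<gamma>) * m \<le> e"
    using a j by (simp add: algebra_simps)
  then have "m \<le> H * e"
    using disc_less by (simp add: H_def field_simps)
  then show ?thesis
    using le[OF i] by simp
qed

section \<open>Existence and uniqueness of the value functions\<close>

lemma policy_value_exists:
  assumes "is_policy D \<pi>"
  shows "\<exists>v. policy_op D \<pi> v = v"
proof (rule exists_fixpoint_of_sup_contraction[where c = \<gamma> and n = "nS D"])
  fix u v :: "nat \<Rightarrow> real" and d i
  assume i: "i < nS D" and d: "\<And>j. j < nS D \<Longrightarrow> \<bar>u j - v j\<bar> \<le> d"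
  have a: "\<pi> i < nA D" using assms i by (auto simp: is_policy_def)
  have uv: "-d \<le> u j - v j \<and> u j - v j \<le> d" if "j < nS D" for j
    using d[OF that] by linarith
  have "-d \<le> mean i (\<pi> i) (\<lambda>j. u j - v j)" "mean i (\<pi> i) (\<lambda>j. u j - v j) \<le> d"
    using mean_bounds[OF i a uv] by simp_all
  then have "\<bar>\<gamma> * mean i (\<pi> i) (\<lambda>j. u j - v j)\<bar> \<le> \<gamma> * d"
    using disc_pos by (simp add: abs_mult)
  then show "\<bar>policy_op D \<pi> u i - policy_op D \<pi> v i\<bar> \<le> \<gamma> * d"
    using i by (simp add: policy_op_def action_value_mean mean_diff algebra_simps)
qed (use disc_pos disc_less in \<open>auto simp: policy_op_def\<close>)

lemma value_op_ge: "i < nS D \<Longrightarrow> a < nA D \<Longrightarrow> rew D i a + \<gamma> * mean i a u \<le> value_op D u i"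
  unfolding value_op_def by (auto simp: action_value_mean intro: Max_ge)

lemma value_op_attained: "i < nS D \<Longrightarrow> \<exists>a<nA D. value_op D u i = rew D i a + \<gamma> * mean i a u"
proof -
  assume i: "i < nS D"
  have "Max ((\<lambda>a. action_value D u i a) ` {..<nA D}) \<in> (\<lambda>a. action_value D u i a) ` {..<nA D}"
    using nA_pos by (intro Max_in) auto
  with i show ?thesis by (auto simp: value_op_def action_value_mean)
qed

lemma opt_value_exists: "\<exists>v. value_op D v = v"
proof (rule exists_fixpoint_of_sup_contraction[where c = \<gamma> and n = "nS D"])
  have le: "value_op D u i - value_op D v i \<le> \<gamma> * d"
    if i: "i < nS D" and d: "\<And>j. j < nS D \<Longrightarrow> \<bar>u j - v j\<bar> \<le> d" for u v d i
  proof -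
    obtain a where a: "a < nA D" "value_op D u i = rew D i a + \<gamma> * mean i a u"
      using value_op_attained[OF i] by blast
    have "mean i a (\<lambda>j. u j - v j) \<le> d"
      using d mean_mono[of "\<lambda>j. u j - v j" "\<lambda>_. d" i a] i a by (simp add: abs_le_iff)
    then have "\<gamma> * mean i a (\<lambda>j. u j - v j) \<le> \<gamma> * d"
      using disc_pos by simp
    then show ?thesis
      using a value_op_ge[OF i a(1), of v] by (simp add: mean_diff algebra_simps)
  qed
  show "\<bar>value_op D u i - value_op D v i\<bar> \<le> \<gamma> * d"
    if "i < nS D" and d: "\<And>j. j < nS D \<Longrightarrow> \<bar>u j - v j\<bar> \<le> d" for u v d i
    using le[OF that] le[of i v u d] that by (simp add: abs_le_iff abs_minus_commute)
qed (use disc_pos disc_less in \<open>auto simp: value_op_def\<close>)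

text \<open>\<open>policy_value\<close> is a \<open>THE\<close>, so uniqueness has to come first. On
  the states it follows from \<open>max_principle\<close> with error 0 in both directions; elsewhere
  \<open>policy_op\<close> forces the value 0.\<close>

lemma policy_value_fix:
  assumes "is_policy D \<pi>"
  shows "policy_op D \<pi> (policy_value D \<pi>) = policy_value D \<pi>"
proof -
  have le: "u i \<le> v i" if uv: "policy_op D \<pi> u = u" "policy_op D \<pi> v = v" and i: "i < nS D" for u v i
  proof -
    have "u i - v i \<le> H * 0"
    proof (rule max_principle[OF _ i])
      fix j assume j: "j < nS D"
      have "u j = rew D j (\<pi> j) + \<gamma> * mean j (\<pi> j) u" "v j = rew D j (\<pi> j) + \<gamma> * mean j (\<pi> j) v"
        using fun_cong[OF uv(1), of j] fun_cong[OF uv(2), of j] j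
        by (simp_all add: policy_op_def action_value_mean)
      then show "\<exists>a<nA D. u j - v j \<le> \<gamma> * mean j a (\<lambda>i. u i - v i) + 0"
        using assms j by (intro exI[of _ "\<pi> j"]) (auto simp: is_policy_def mean_diff algebra_simps)
    qed
    then show ?thesis by simp
  qed
  have "u = v" if uv: "policy_op D \<pi> u = u" "policy_op D \<pi> v = v" for u v
  proof
    fix i show "u i = v i"
      using le[OF uv] le[OF uv(2,1)] fun_cong[OF uv(1), of i] fun_cong[OF uv(2), of i]
      by (cases "i < nS D") (auto simp: policy_op_def intro: antisym)
  qed
  then have "\<exists>!v. policy_op D \<pi> v = v"
    using policy_value_exists[OF assms] by blast
  from theI'[OF this] show ?thesis unfolding policy_value_def .
qed

lemma opt_value_fix: "value_op D (opt_value D) = opt_value D"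
proof -
  have le: "u i \<le> v i" if uv: "value_op D u = u" "value_op D v = v" and i: "i < nS D" for u v i
  proof -
    have "u i - v i \<le> H * 0"
    proof (rule max_principle[OF _ i])
      fix j assume j: "j < nS D"
      obtain a where a: "a < nA D" "u j = rew D j a + \<gamma> * mean j a u"
        using value_op_attained[OF j, of u] uv by auto
      then show "\<exists>a<nA D. u j - v j \<le> \<gamma> * mean j a (\<lambda>i. u i - v i) + 0"
        using value_op_ge[OF j a(1), of v] uv
        by (intro exI[of _ a]) (auto simp: mean_diff algebra_simps)
    qed
    then show ?thesis by simp
  qed
  have "u = v" if uv: "value_op D u = u" "value_op D v = v" for u v
  proof
    fix i show "u i = v i"
      using le[OF uv] le[OF uv(2,1)] fun_cong[OF uv(1), of i] fun_cong[OF uv(2), of i]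
      by (cases "i < nS D") (auto simp: value_op_def intro: antisym)
  qed
  then have "\<exists>!v. value_op D v = v"
    using opt_value_exists by blast
  from theI'[OF this] show ?thesis unfolding opt_value_def .
qed

section \<open>Bounds and comparisons of values\<close>

lemma opt_value_ge:
  "i < nS D \<Longrightarrow> a < nA D \<Longrightarrow> rew D i a + \<gamma> * mean i a (opt_value D) \<le> opt_value D i"
  using value_op_ge[of i a "opt_value D"] by (simp add: opt_value_fix)

lemma opt_value_attained:
  "i < nS D \<Longrightarrow> \<exists>a<nA D. opt_value D i = rew D i a + \<gamma> * mean i a (opt_value D)"
  using value_op_attained[of i "opt_value D"] by (simp add: opt_value_fix)

lemma policy_value_eq:
  "is_policy D \<pi> \<Longrightarrow> i < nS D \<Longrightarrow>
    policy_value D \<pi> i = rew D i (\<pi> i) + \<gamma> * mean i (\<pi> i) (policy_value D \<pi>)"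
  using fun_cong[OF policy_value_fix, of \<pi> i] by (simp add: policy_op_def action_value_mean)

lemma policy_value_le_opt:
  assumes \<pi>: "is_policy D \<pi>" and i: "i < nS D"
  shows "policy_value D \<pi> i \<le> opt_value D i"
proof -
  have "policy_value D \<pi> i - opt_value D i \<le> H * 0"
  proof (rule max_principle[OF _ i])
    fix j assume j: "j < nS D"
    then show "\<exists>a<nA D. policy_value D \<pi> j - opt_value D j
        \<le> \<gamma> * mean j a (\<lambda>i. policy_value D \<pi> i - opt_value D i) + 0"
      using \<pi> policy_value_eq[OF \<pi> j] opt_value_ge[OF j, of "\<pi> j"]
      by (intro exI[of _ "\<pi> j"]) (auto simp: mean_diff is_policy_def algebra_simps)
  qed
  then show ?thesis by simp
qed

lemma opt_value_le: "i < nS D \<Longrightarrow> opt_value D i \<le> H * M"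
proof (rule max_principle)
  fix j assume j: "j < nS D"
  obtain a where "a < nA D" "opt_value D j = rew D j a + \<gamma> * mean j a (opt_value D)"
    using opt_value_attained[OF j] by blast
  with rew_bounds[OF j this(1)] show "\<exists>a<nA D. opt_value D j \<le> \<gamma> * mean j a (opt_value D) + M"
    by auto
qed

text \<open>For \<open>V = v + H * M\<close> the summand \<open>M\<close> is (1 - \<gamma>) H M, so
  the hypothesis says v <= T_\<pi> v and the maximum principle gives v <= v_\<pi>. This is how
  stored values become a guarantee on the stored policy.\<close>

lemma policy_value_ge_sub:
  assumes \<pi>: "is_policy D \<pi>" and i: "i < nS D"
    and V: "\<And>j. j < nS D \<Longrightarrow> V j \<le> rew D j (\<pi> j) + M + \<gamma> * mean j (\<pi> j) V"
  shows "V i - H * M \<le> policy_value D \<pi> i"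
proof -
  have "V i - policy_value D \<pi> i - H * M \<le> H * 0"
  proof (rule max_principle[OF _ i])
    fix j assume j: "j < nS D"
    have a: "\<pi> j < nA D" using \<pi> j by (auto simp: is_policy_def)
    have "\<gamma> * (H * M) = H * M - M"
      using R_disc by (simp add: R_def algebra_simps)
    moreover have "mean j (\<pi> j) (\<lambda>i. V i - policy_value D \<pi> i - H * M)
        = mean j (\<pi> j) V - mean j (\<pi> j) (policy_value D \<pi>) - H * M"
      using j a by (simp only: mean_diff mean_const)
    ultimately have "\<gamma> * mean j (\<pi> j) (\<lambda>i. V i - policy_value D \<pi> i - H * M)
        = \<gamma> * mean j (\<pi> j) V - \<gamma> * mean j (\<pi> j) (policy_value D \<pi>) - (H * M - M)"
      by (simp add: right_diff_distrib)
    then show "\<exists>a<nA D. V j - policy_value D \<pi> j - H * M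
        \<le> \<gamma> * mean j a (\<lambda>i. V i - policy_value D \<pi> i - H * M) + 0"
      using V[OF j] policy_value_eq[OF \<pi> j] a j
      by (intro exI[of _ "\<pi> j"]) simp
  qed
  then show ?thesis by simp
qed

lemma eps_optimalI:
  assumes \<pi>: "is_policy D \<pi>"
    and le: "\<And>i. i < nS D \<Longrightarrow> opt_value D i - policy_value D \<pi> i \<le> \<epsilon>"
  shows "eps_optimal D \<epsilon> \<pi>"
proof -
  have "\<bar>opt_value D i - policy_value D \<pi> i\<bar> \<le> \<epsilon>" if "i < nS D" for i
    using le[OF that] policy_value_le_opt[OF \<pi> that] by simp
  then show ?thesis
    using \<pi> nS_pos unfolding eps_optimal_def sup_norm_def by (subst Max_le_iff) auto
qed

text \<open>All values lie in an interval of length \<open>R\<close>; its lower end comes from the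
  vector v = -H M, that is \<open>V = 0\<close>.\<close>

lemma eps_optimal_trivial:
  assumes "R \<le> \<epsilon>" "is_policy D \<pi>"
  shows "eps_optimal D \<epsilon> \<pi>"
proof (rule eps_optimalI[OF assms(2)])
  fix i assume i: "i < nS D"
  have "0 - H * M \<le> policy_value D \<pi> i"
  proof (rule policy_value_ge_sub[OF assms(2) i])
    fix j assume j: "j < nS D"
    then have "\<pi> j < nA D" using assms(2) by (auto simp: is_policy_def)
    then show "0 \<le> rew D j (\<pi> j) + M + \<gamma> * mean j (\<pi> j) (\<lambda>_. 0)"
      using rew_bounds[OF j, of "\<pi> j"] j by simp
  qed
  then show "opt_value D i - policy_value D \<pi> i \<le> \<epsilon>"
    using opt_value_le[OF i] assms(1) by (simp add: R_def)
qed

end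

section \<open>Sweeps with underestimated values\<close>

context discounted_mdp
begin

definition variance :: "nat \<Rightarrow> nat \<Rightarrow> (nat \<Rightarrow> real) \<Rightarrow> real" where
  "variance i a u = mean i a (\<lambda>j. (u j)\<^sup>2) - (mean i a u)\<^sup>2"

lemma variance_eq:
  assumes "i < nS D" "a < nA D"
  shows "variance i a u = mean i a (\<lambda>j. (u j - mean i a u)\<^sup>2)"
proof -
  let ?m = "mean i a u"
  have "mean i a (\<lambda>j. (u j - ?m)\<^sup>2) = mean i a (\<lambda>j. (u j)\<^sup>2 - (2 * ?m) * u j + ?m\<^sup>2)"
    by (simp add: power2_diff algebra_simps)
  also have "\<dots> = mean i a (\<lambda>j. (u j)\<^sup>2) - (2 * ?m) * ?m + ?m\<^sup>2"
    using assms by (simp only: mean_add mean_diff mean_cmult mean_const)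
  finally show ?thesis
    by (simp add: variance_def power2_eq_square)
qed

lemma variance_nonneg: "i < nS D \<Longrightarrow> a < nA D \<Longrightarrow> 0 \<le> variance i a u"
  using mean_mono[of "\<lambda>_. 0" "\<lambda>j. (u j - mean i a u)\<^sup>2" i a] by (simp add: variance_eq)

lemma mean_const_diff:
  "i < nS D \<Longrightarrow> a < nA D \<Longrightarrow> mean i a (\<lambda>j. c - u j) = c - mean i a u"
  by (simp add: mean_diff)

lemma variance_const_diff:
  assumes "i < nS D" "a < nA D"
  shows "variance i a (\<lambda>j. c - u j) = variance i a u"
  using assms by (simp add: variance_eq mean_const_diff power2_commute)

text \<open>The lower end of what a successful update may compute. One half of each doubled term is
  deliberate: the penalty in \<open>pair_stat\<close> and the \<open>\<beta>\<close> subtracted in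
  \<open>improve\<close>. The other half is the allowed deviation. The \<open>M\<close> is H M -
  \<gamma> H M, from the shift by H M.\<close>

definition lower_backup :: "real \<Rightarrow> real \<Rightarrow> (nat \<Rightarrow> real) \<Rightarrow> nat \<Rightarrow> nat \<Rightarrow> real" where
  "lower_backup \<eta> \<beta> u i a =
     rew D i a + M + \<gamma> * (mean i a u - 2 * \<eta> * variance i a u - 2 * \<beta>)"

text \<open>Raising \<open>u\<close> to \<open>V\<close> raises the mean by some d >= 0 and the
  variance by at most 2 R d, so for 4 \<eta> R <= 1 the penalty cannot outweigh the gain. Needed
  because updates are made in place: an estimate uses the current vector, the analysis of a sweep
  its initial one.\<close>

lemma lower_backup_mono:
  assumes i: "i < nS D" and a: "a < nA D" and \<eta>: "0 \<le> \<eta>" "4 * \<eta> * R \<le> 1"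
    and uV: "\<And>j. j < nS D \<Longrightarrow> 0 \<le> u j \<and> u j \<le> V j \<and> V j \<le> R"
  shows "lower_backup \<eta> \<beta> u i a \<le> lower_backup \<eta> \<beta> V i a"
proof -
  let ?d = "mean i a V - mean i a u"
  have "u j \<le> V j" if "j < nS D" for j using uV[OF that] by simp
  then have d: "0 \<le> ?d"
    using mean_mono[of u V i a] by simp
  have "0 \<le> mean i a u" "0 \<le> mean i a V"
  proof -
    have "0 \<le> u j \<and> u j \<le> R" "0 \<le> V j \<and> V j \<le> R" if "j < nS D" for j
      using uV[OF that] by auto
    then show "0 \<le> mean i a u" "0 \<le> mean i a V"
      using mean_bounds(1)[OF i a, of 0 _ R] by auto
  qed
  then have sq: "(mean i a u)\<^sup>2 \<le> (mean i a V)\<^sup>2"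
    using d by (intro power_mono) auto
  have "(V j)\<^sup>2 - (u j)\<^sup>2 \<le> (2 * R) * (V j - u j)" if "j < nS D" for j
  proof -
    have "(V j)\<^sup>2 - (u j)\<^sup>2 = (V j + u j) * (V j - u j)"
      by (simp add: power2_eq_square algebra_simps)
    also have "\<dots> \<le> (2 * R) * (V j - u j)"
      using uV[OF that] by (intro mult_right_mono) auto
    finally show ?thesis .
  qed
  then have "mean i a (\<lambda>j. (V j)\<^sup>2 - (u j)\<^sup>2) \<le> mean i a (\<lambda>j. (2 * R) * (V j - u j))"
    by (rule mean_mono)
  then have "mean i a (\<lambda>j. (V j)\<^sup>2) - mean i a (\<lambda>j. (u j)\<^sup>2) \<le> 2 * R * ?d"
    by (simp only: mean_cmult mean_diff)
  with sq have "variance i a V - variance i a u \<le> 2 * R * ?d"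
    by (simp add: variance_def)
  then have "2 * \<eta> * (variance i a V - variance i a u) \<le> 2 * \<eta> * (2 * R * ?d)"
    using \<eta> by (intro mult_left_mono) auto
  also have "\<dots> = (4 * \<eta> * R) * ?d" by simp
  also have "\<dots> \<le> 1 * ?d" using \<eta> d by (intro mult_right_mono) auto
  finally have "mean i a u - 2 * \<eta> * variance i a u \<le> mean i a V - 2 * \<eta> * variance i a V"
    by (simp add: algebra_simps)
  then show ?thesis
    using disc_pos by (simp add: lower_backup_def)
qed

text \<open>One step of the potential \<open>w + 4\<eta>w\<^sup>2\<close>: its quadratic part absorbs the variances, which
  would otherwise accumulate to \<open>H\<close> times their maximal size.\<close>

lemma potential_step:
  fixes W m s c g \<eta> \<beta> R :: real
  assumes W: "0 \<le> W" "W \<le> R" and m: "0 \<le> m" "m \<le> R" and v: "0 \<le> s - m\<^sup>2"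
    and c: "0 \<le> c" and g: "0 \<le> g" "g \<le> 1" and \<eta>: "0 \<le> \<eta>" "8 * \<eta> * R \<le> 1" and \<beta>: "0 \<le> \<beta>"
    and le: "W \<le> c + g * (m + 2 * \<eta> * (s - m\<^sup>2) + 2 * \<beta>)"
  shows "W + 4 * \<eta> * W\<^sup>2 \<le> g * (m + 4 * \<eta> * s) + c + 2 * \<beta> + 8 * \<eta> * R * (c + 2 * \<beta>)"
proof -
  define v where "v = s - m\<^sup>2"
  have v0: "0 \<le> v" using v by (simp add: v_def)
  define b where "b = c + 2 * \<eta> * (g * v) + 2 * \<beta>"
  have R: "0 \<le> R" using W by simp
  have gv: "0 \<le> g * v" using g v0 by simp
  have gb: "g * \<beta> \<le> \<beta>" using g \<beta> by (simp add: mult_left_le_one_le)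
  have b: "0 \<le> b" using c \<eta> gv \<beta> by (simp add: b_def)
  have Wb: "W - g * m \<le> b"
    using le gb by (simp add: b_def v_def[symmetric] algebra_simps)
  have gm: "0 \<le> g * m" "g * m \<le> R"
    using g m by (auto intro: order_trans[OF mult_left_le_one_le])
  have "W\<^sup>2 - (g * m)\<^sup>2 = (W - g * m) * (W + g * m)"
    by (simp add: power2_eq_square algebra_simps)
  also have "\<dots> \<le> b * (2 * R)"
    using Wb b W gm by (intro order_trans[OF mult_right_mono[OF Wb] mult_left_mono]) auto
  finally have "W\<^sup>2 \<le> (g * m)\<^sup>2 + 2 * R * b" by (simp add: mult.commute)
  also have "(g * m)\<^sup>2 \<le> g * m\<^sup>2"
    using mult_right_mono[of "g * g" g "m\<^sup>2"] g
    by (simp add: power2_eq_square mult_ac mult_left_le_one_le)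
  \<comment> \<open>Substituting m^2 = s - v produces -g v. Times 4 \<eta> it pays for 2 \<eta> g v
    in the bound on \<open>W\<close> and for another 2 \<eta> g v from the variance inside
    \<open>b\<close>, where 8 \<eta> R <= 1 enters. This fixes the coefficient 4 of the
    potential.\<close>
  finally have "W\<^sup>2 \<le> g * s - g * v + 2 * R * b"
    by (simp add: v_def algebra_simps)
  then have "4 * \<eta> * W\<^sup>2 \<le> 4 * \<eta> * (g * s - g * v + 2 * R * b)"
    using \<eta> by (intro mult_left_mono) auto
  also have "\<dots> = 4 * \<eta> * g * s - 4 * \<eta> * (g * v) + 8 * \<eta> * R * (c + 2 * \<beta>)
      + (8 * \<eta> * R) * (2 * \<eta> * (g * v))"
    by (simp add: b_def algebra_simps)
  also have "(8 * \<eta> * R) * (2 * \<eta> * (g * v)) \<le> 1 * (2 * \<eta> * (g * v))"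
    using \<eta> gv by (intro mult_right_mono) auto
  finally show ?thesis
    using Wb by (simp add: b_def algebra_simps)
qed

text \<open>The gap is measured from the constant H M because this does not change variances; the
  price is the reward gap c = M - r, up to 2 M per step. Along an action optimal for
  \<open>opt_value\<close>, the function H M - \<open>opt_value\<close> obeys the same recursion
  with equality, so subtracting it cancels c except inside the small term with factor 8 \<eta>
  R.\<close>

lemma sweep_contraction:
  assumes \<eta>: "0 \<le> \<eta>" "8 * \<eta> * R \<le> 1" and \<beta>: "0 \<le> \<beta>"
    and uV: "\<And>j. j < nS D \<Longrightarrow> 0 \<le> u j \<and> u j \<le> V j \<and> V j \<le> R"
    and pot: "\<And>j. j < nS D \<Longrightarrow> (R - u j) + 4 * \<eta> * (R - u j)\<^sup>2 - (H * M - opt_value D j) \<le> B"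
    and lb: "\<And>j b. j < nS D \<Longrightarrow> b < nA D \<Longrightarrow> lower_backup \<eta> \<beta> u j b \<le> V j"
    and i: "i < nS D"
  shows "(R - V i) + 4 * \<eta> * (R - V i)\<^sup>2 - (H * M - opt_value D i)
     \<le> \<gamma> * B + (2 * \<beta> + 8 * \<eta> * R * (2 * M + 2 * \<beta>))"
proof -
  obtain a where a: "a < nA D" "opt_value D i = rew D i a + \<gamma> * mean i a (opt_value D)"
    using opt_value_attained[OF i] by blast
  let ?w = "\<lambda>j. R - u j"
  let ?m = "mean i a ?w" and ?s = "mean i a (\<lambda>j. (?w j)\<^sup>2)"
  define c where "c = M - rew D i a"
  have c: "0 \<le> c" "c \<le> 2 * M" using rew_bounds[OF i a(1)] by (auto simp: c_def)
  have m: "?m = R - mean i a u" by (rule mean_const_diff[OF i a(1)])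
  have "0 \<le> ?w j \<and> ?w j \<le> R" if "j < nS D" for j using uV[OF that] by auto
  then have m_bounds: "0 \<le> ?m" "?m \<le> R"
    using mean_bounds[OF i a(1), of 0 ?w R] by auto
  have v: "variance i a u = ?s - ?m\<^sup>2"
    using variance_const_diff[OF i a(1), of R u] by (simp add: variance_def)
  have "R - V i \<le> R - lower_backup \<eta> \<beta> u i a" using lb[OF i a(1)] by simp
  also have "\<dots> = c + \<gamma> * (?m + 2 * \<eta> * (?s - ?m\<^sup>2) + 2 * \<beta>)"
    using R_disc by (simp add: lower_backup_def c_def v m algebra_simps)
  finally have W: "R - V i \<le> c + \<gamma> * (?m + 2 * \<eta> * (?s - ?m\<^sup>2) + 2 * \<beta>)" .
  have "0 \<le> R - V i" "R - V i \<le> R" using uV[OF i] by auto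
  moreover have "0 \<le> ?s - ?m\<^sup>2"
    using variance_nonneg[OF i a(1), of u] by (simp add: v)
  ultimately have "(R - V i) + 4 * \<eta> * (R - V i)\<^sup>2 \<le> \<gamma> * (?m + 4 * \<eta> * ?s)
      + c + 2 * \<beta> + 8 * \<eta> * R * (c + 2 * \<beta>)"
    using W m_bounds c disc_pos disc_less \<eta> \<beta> by (intro potential_step) auto
  moreover have "8 * \<eta> * R * (c + 2 * \<beta>) \<le> 8 * \<eta> * R * (2 * M + 2 * \<beta>)"
    using c \<eta> R_pos by (intro mult_left_mono) auto
  moreover have "?m + 4 * \<eta> * ?s - (H * M - mean i a (opt_value D)) \<le> B"
  proof -
    have "mean i a (\<lambda>j. ?w j + (4 * \<eta>) * (?w j)\<^sup>2 - (H * M - opt_value D j)) \<le> B"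
      using pot mean_mono[of "\<lambda>j. ?w j + (4 * \<eta>) * (?w j)\<^sup>2 - (H * M - opt_value D j)" "\<lambda>_. B" i a]
        i a by simp
    moreover have "mean i a (\<lambda>j. ?w j + (4 * \<eta>) * (?w j)\<^sup>2 - (H * M - opt_value D j))
        = ?m + (4 * \<eta>) * ?s - (H * M - mean i a (opt_value D))"
      using i a by (simp only: mean_add mean_diff mean_cmult mean_const)
    ultimately show ?thesis by simp
  qed
  then have "\<gamma> * (?m + 4 * \<eta> * ?s - (H * M - mean i a (opt_value D))) \<le> \<gamma> * B"
    using disc_pos by simp
  moreover have "H * M - opt_value D i = c + \<gamma> * (H * M - mean i a (opt_value D))"
    using a R_disc by (simp add: c_def R_def algebra_simps)
  ultimately show ?thesis
    by (simp add: right_diff_distrib)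
qed

end

section \<open>Choice of parameters and the invariant of the sweeps\<close>

locale sampled_value_iteration = discounted_mdp +
  fixes \<epsilon> :: real
  assumes eps_pos: "0 < \<epsilon>" and eps_less: "\<epsilon> < R"
begin

text \<open>The sample size is proportional to 1 / (\<eta> \<beta>), so both are taken as large, up
  to constants, as the loss of \<epsilon>/H affordable per sweep permits.\<close>

definition \<eta> :: real where "\<eta> = \<epsilon> / (32 * (R * R))"

definition \<beta> :: real where "\<beta> = \<epsilon> / (16 * H)"

lemma \<eta>_pos: "0 < \<eta>" and \<beta>_pos: "0 < \<beta>"
  using eps_pos R_pos H_pos by (auto simp: \<eta>_def \<beta>_def)

lemma \<eta>_R: "32 * \<eta> * R = \<epsilon> / R"
  using R_pos by (simp add: \<eta>_def field_simps)

lemma \<eta>_R_le: "32 * \<eta> * R \<le> 1"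
  using \<eta>_R eps_less R_pos by simp

text \<open>The terms are \<epsilon>/(8 H), \<epsilon>/(4 H) and a cross term of at most
  \<epsilon>/(32 H). Since 1/H = 1 - \<gamma>, the recursion B -> \<gamma> B + x \<epsilon>/H has
  the fixed point x \<epsilon>, so the losses never exceed 13/32 \<epsilon> in total.\<close>

lemma sweep_loss: "2 * \<beta> + 8 * \<eta> * R * (2 * M + 2 * \<beta>) \<le> 13 / 32 * \<epsilon> / H"
proof -
  have 1: "8 * \<eta> * R * (2 * M) = \<epsilon> / (4 * H)"
    using \<eta>_R H_pos M_pos R_pos by (simp add: R_def field_simps)
  have "(32 * \<eta> * R) * \<beta> \<le> 1 * \<beta>"
    using \<eta>_R_le \<beta>_pos by (intro mult_right_mono) auto
  then have "8 * \<eta> * R * (2 * \<beta>) \<le> \<beta> / 2" by simp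
  with 1 have "2 * \<beta> + 8 * \<eta> * R * (2 * M + 2 * \<beta>) \<le> 5 / 2 * \<beta> + \<epsilon> / (4 * H)"
    by (simp add: distrib_left)
  also have "\<dots> = 13 / 32 * \<epsilon> / H"
    using H_pos by (simp add: \<beta>_def field_simps)
  finally show ?thesis .
qed

text \<open>The invariant between two updates, when the current sweep has reached the pair
  \<open>(i, a)\<close>. The program stores \<open>V = v + HM\<close>, so that the initial underestimate
  \<open>v = -HM\<close> is the zero vector; \<open>u\<close> is the value of \<open>V\<close> at the beginning of the sweep.\<close>

definition good :: "(nat \<Rightarrow> real) \<Rightarrow> (nat \<Rightarrow> nat) \<Rightarrow> nat \<Rightarrow> nat \<Rightarrow> nat \<Rightarrow> bool" where
  "good V \<pi> k i a \<longleftrightarrow>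
    (\<forall>j<nS D. 0 \<le> V j \<and> V j \<le> R \<and> \<pi> j < nA D \<and> V j \<le> rew D j (\<pi> j) + M + \<gamma> * mean j (\<pi> j) V) \<and>
    (\<exists>u. (\<forall>j<nS D. 0 \<le> u j \<and> u j \<le> V j \<and>
            (R - u j) + 4 * \<eta> * (R - u j)\<^sup>2 - (H * M - opt_value D j)
              \<le> \<gamma> ^ k * (9 / 8 * R) + 13 / 32 * \<epsilon>) \<and>
         (\<forall>j<nS D. \<forall>b<nA D. j < i \<or> j = i \<and> b < a \<longrightarrow> lower_backup \<eta> \<beta> u j b \<le> V j))"

text \<open>The 9/8 consists of the initial gap \<open>R\<close> and the quadratic part, at most R/8
  because 32 \<eta> R <= 1.\<close>

lemma good_init: "good (\<lambda>_. 0) (\<lambda>_. 0) 0 0 0"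
proof -
  have "0 \<le> rew D j 0 + M + \<gamma> * mean j 0 (\<lambda>_. 0)" if "j < nS D" for j
    using rew_bounds[OF that, of 0] nA_pos by (simp add: mean_def)
  moreover have "R + 4 * \<eta> * R\<^sup>2 - (H * M - opt_value D j) \<le> 9 / 8 * R + 13 / 32 * \<epsilon>"
    if "j < nS D" for j
  proof -
    have "(32 * \<eta> * R) * R \<le> 1 * R" using \<eta>_R_le R_pos by (intro mult_right_mono) auto
    then have "4 * \<eta> * R\<^sup>2 \<le> R / 8" by (simp add: power2_eq_square)
    then show ?thesis using opt_value_le[OF that] eps_pos by simp
  qed
  ultimately show ?thesis
    using R_pos nA_pos unfolding good_def by (auto intro!: exI[of _ "\<lambda>_. 0"])
qed

text \<open>The vector only grows. Where it is unchanged, the right-hand side of V <= T_\<pi> V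
  grows; at \<open>i\<close> the action \<open>a\<close> is recorded together with \<open>q\<close>,
  which is at most the exact backup of \<open>a\<close>. \<open>lower_backup_mono\<close> passes
  from the current \<open>V\<close> to the vector \<open>u\<close> of the sweep's beginning.\<close>

lemma good_update:
  assumes g: "good V \<pi> k i a" and i: "i < nS D" and a: "a < nA D"
    and q: "lower_backup \<eta> \<beta> V i a \<le> q" "q \<le> rew D i a + M + \<gamma> * mean i a V"
    and V': "V' = (if V i < q then V(i := q) else V)"
    and \<pi>': "\<pi>' = (if V i < q then \<pi>(i := a) else \<pi>)"
  shows "good V' \<pi>' k i (Suc a)"
proof -
  have base: "0 \<le> V j" "V j \<le> R" "\<pi> j < nA D"
      "V j \<le> rew D j (\<pi> j) + M + \<gamma> * mean j (\<pi> j) V" if "j < nS D" for j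
    using g that unfolding good_def by blast+
  obtain u where u: "\<And>j. j < nS D \<Longrightarrow> 0 \<le> u j \<and> u j \<le> V j"
      "\<And>j. j < nS D \<Longrightarrow> (R - u j) + 4 * \<eta> * (R - u j)\<^sup>2 - (H * M - opt_value D j)
              \<le> \<gamma> ^ k * (9 / 8 * R) + 13 / 32 * \<epsilon>"
      "\<And>j b. j < nS D \<Longrightarrow> b < nA D \<Longrightarrow> j < i \<or> j = i \<and> b < a \<Longrightarrow> lower_backup \<eta> \<beta> u j b \<le> V j"
    using g unfolding good_def by blast
  have le: "V j \<le> V' j" for j by (simp add: V')
  have mean_le: "mean j b V \<le> mean j b V'" for j b by (rule mean_mono) (rule le)
  have "mean i a V \<le> R"
    using mean_bounds(2)[OF i a, of 0 V R] base by auto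
  then have "\<gamma> * mean i a V \<le> \<gamma> * R" using disc_pos by simp
  \<comment> \<open>\<open>R\<close> is the fixed point of x -> 2 M + \<gamma> x, so updates stay in
    the range.\<close>
  then have qR: "q \<le> R"
    using q(2) rew_bounds[OF i a] R_disc by linarith
  have "lower_backup \<eta> \<beta> u i a \<le> lower_backup \<eta> \<beta> V i a"
    using u(1) base \<eta>_pos \<eta>_R_le by (intro lower_backup_mono i a) auto
  then have new: "lower_backup \<eta> \<beta> u i a \<le> V' i" using q(1) by (simp add: V')
  have 1: "0 \<le> V' j \<and> V' j \<le> R \<and> \<pi>' j < nA D \<and> V' j \<le> rew D j (\<pi>' j) + M + \<gamma> * mean j (\<pi>' j) V'"
    if j: "j < nS D" for j
  proof -
    have "\<gamma> * mean j (\<pi> j) V \<le> \<gamma> * mean j (\<pi> j) V'" "\<gamma> * mean i a V \<le> \<gamma> * mean i a V'"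
      using mean_le disc_pos by auto
    then have "V' j \<le> rew D j (\<pi>' j) + M + \<gamma> * mean j (\<pi>' j) V'"
      using base(4)[OF j] q(2)
      by (cases "j = i \<and> V i < q") (auto simp: \<pi>' V' simp del: mult_le_cancel_left_pos)
    then show ?thesis
      using base[OF j] qR a le[of j] by (auto simp: V' \<pi>')
  qed
  have 2: "0 \<le> u j \<and> u j \<le> V' j" if "j < nS D" for j
    using u(1)[OF that] le[of j] by linarith
  have 3: "lower_backup \<eta> \<beta> u j b \<le> V' j"
    if "j < nS D" "b < nA D" "j < i \<or> j = i \<and> b < Suc a" for j b
  proof (cases "j = i \<and> b = a")
    case False
    then show ?thesis using u(3)[OF that(1,2)] that(3) le[of j] by fastforce
  qed (use new in simp)
  show ?thesis
    unfolding good_def using 1 2 3 u(2) by blast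
qed

lemma good_next_state: "good V \<pi> k i (nA D) \<Longrightarrow> good V \<pi> k (Suc i) 0"
  unfolding good_def less_Suc_eq by blast

lemma good_next_sweep:
  assumes g: "good V \<pi> k (nS D) 0"
  shows "good V \<pi> (Suc k) 0 0"
proof -
  have base: "0 \<le> V j \<and> V j \<le> R \<and> \<pi> j < nA D \<and> V j \<le> rew D j (\<pi> j) + M + \<gamma> * mean j (\<pi> j) V"
    if "j < nS D" for j
    using g that unfolding good_def by blast
  define B where "B = \<gamma> ^ k * (9 / 8 * R) + 13 / 32 * \<epsilon>"
  obtain u where u: "\<And>j. j < nS D \<Longrightarrow> 0 \<le> u j \<and> u j \<le> V j"
      "\<And>j. j < nS D \<Longrightarrow> (R - u j) + 4 * \<eta> * (R - u j)\<^sup>2 - (H * M - opt_value D j) \<le> B"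
      "\<And>j b. j < nS D \<Longrightarrow> b < nA D \<Longrightarrow> lower_backup \<eta> \<beta> u j b \<le> V j"
    using g unfolding good_def B_def by blast
  have "(R - V j) + 4 * \<eta> * (R - V j)\<^sup>2 - (H * M - opt_value D j)
      \<le> \<gamma> ^ Suc k * (9 / 8 * R) + 13 / 32 * \<epsilon>" if j: "j < nS D" for j
  proof -
    have "(R - V j) + 4 * \<eta> * (R - V j)\<^sup>2 - (H * M - opt_value D j)
        \<le> \<gamma> * B + (2 * \<beta> + 8 * \<eta> * R * (2 * M + 2 * \<beta>))"
      using u base \<eta>_pos \<beta>_pos \<eta>_R_le j by (intro sweep_contraction[of \<eta> \<beta> u V]) auto
    also have "\<dots> \<le> \<gamma> * B + 13 / 32 * \<epsilon> / H"
      using sweep_loss by simp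
    also have "13 / 32 * \<epsilon> / H = 13 / 32 * \<epsilon> - \<gamma> * (13 / 32 * \<epsilon>)"
      by (simp add: H_def field_simps)
    also have "\<gamma> * B + (13 / 32 * \<epsilon> - \<gamma> * (13 / 32 * \<epsilon>)) = \<gamma> ^ Suc k * (9 / 8 * R) + 13 / 32 * \<epsilon>"
      by (simp add: B_def algebra_simps)
    finally show ?thesis .
  qed
  \<comment> \<open>The next sweep starts from \<open>V\<close> itself, and at position (0, 0) the
    condition on completed backups is vacuous.\<close>
  with base show ?thesis
    unfolding good_def by (intro conjI exI[of _ V]) auto
qed

lemma good_eps_optimal:
  assumes g: "good V \<pi> k i a" and k: "\<gamma> ^ k * (2 * R) \<le> \<epsilon>"
  shows "eps_optimal D \<epsilon> \<pi>"
proof (rule eps_optimalI)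
  have base: "0 \<le> V j" "V j \<le> R" "\<pi> j < nA D"
      "V j \<le> rew D j (\<pi> j) + M + \<gamma> * mean j (\<pi> j) V" if "j < nS D" for j
    using g that unfolding good_def by blast+
  show \<pi>: "is_policy D \<pi>" using base by (auto simp: is_policy_def)
  fix j assume j: "j < nS D"
  obtain u where u: "u j \<le> V j"
      "(R - u j) + 4 * \<eta> * (R - u j)\<^sup>2 - (H * M - opt_value D j)
          \<le> \<gamma> ^ k * (9 / 8 * R) + 13 / 32 * \<epsilon>"
    using g j unfolding good_def by blast
  \<comment> \<open>Dropping the quadratic part leaves the optimal value minus u - H M, which is at
    most (9/16 + 13/32) \<epsilon> = 31/32 \<epsilon>.\<close>
  have "0 \<le> 4 * \<eta> * (R - u j)\<^sup>2" using \<eta>_pos by simp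
  moreover have "\<gamma> ^ k * (9 / 8 * R) = 9 / 16 * (\<gamma> ^ k * (2 * R))" by simp
  moreover have "R = 2 * (H * M)" by (simp add: R_def)
  ultimately have "opt_value D j - (V j - H * M) \<le> \<epsilon>"
    using u k eps_pos by linarith
  then show "opt_value D j - policy_value D \<pi> j \<le> \<epsilon>"
    using policy_value_ge_sub[OF \<pi> j base(4)] by simp
qed

end

section \<open>Concentration\<close>

lemma exp_le_quadratic:
  fixes x :: real
  assumes "\<bar>x\<bar> \<le> 1"
  shows "exp x \<le> 1 + x + x\<^sup>2"
proof (cases "0 \<le> x")
  case True
  then show ?thesis using exp_bound[of x] assms by simp
next
  case False
  define y where "y = -x"
  have y: "0 < y" "y \<le> 1" using False assms by (auto simp: y_def)
  \<comment> \<open>The claim for x = -y is that (1 - y + y^2) exp y >= 1; the quadratic Taylor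
    bound for exp y already suffices.\<close>
  have "1 + y + y\<^sup>2 / 2 \<le> exp y" using exp_lower_Taylor_quadratic[of y] y by simp
  moreover have "1 \<le> (1 - y + y\<^sup>2) * (1 + y + y\<^sup>2 / 2)"
  proof -
    have "(1 - y + y\<^sup>2) * (1 + y + y\<^sup>2 / 2) = 1 + y\<^sup>2 / 2 + y ^ 3 / 2 + y ^ 4 / 2"
      by (simp add: field_simps power2_eq_square power3_eq_cube power4_eq_xxxx)
    then show ?thesis using y by simp
  qed
  moreover have pos: "0 \<le> 1 - y + y\<^sup>2" using y by (simp add: add_nonneg_nonneg)
  ultimately have "1 \<le> (1 - y + y\<^sup>2) * exp y"
    by (meson mult_left_mono order_trans)
  then have "exp (-y) * 1 \<le> exp (-y) * ((1 - y + y\<^sup>2) * exp y)"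
    by (intro mult_left_mono) auto
  also have "\<dots> = 1 - y + y\<^sup>2"
    by (simp add: exp_minus)
  finally show ?thesis by (simp add: y_def)
qed

section \<open>Moments of the paired statistic\<close>

context discounted_mdp
begin

abbreviation mean2 :: "nat \<Rightarrow> nat \<Rightarrow> (nat \<Rightarrow> nat \<Rightarrow> real) \<Rightarrow> real" where
  "mean2 i a h \<equiv> mean i a (\<lambda>j. mean i a (h j))"

text \<open>The pairs make the variance penalty unbiased: the expectation over independent \<open>j\<close>, \<open>l\<close>
  is the mean of \<open>V\<close> minus \<open>\<eta>\<close> times its variance.\<close>

definition pair_stat :: "real \<Rightarrow> (nat \<Rightarrow> real) \<Rightarrow> nat \<Rightarrow> nat \<Rightarrow> real" where
  "pair_stat \<eta> V j l = V j - \<eta> / 2 * ((V j - V l) * (V j - V l))"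

lemma mean2_square_diff:
  assumes ia: "i < nS D" "a < nA D"
  shows "mean2 i a (\<lambda>j l. (V j - V l)\<^sup>2) = 2 * variance i a V"
proof -
  let ?m = "mean i a V" and ?s = "mean i a (\<lambda>j. (V j)\<^sup>2)"
  have "mean i a (\<lambda>l. (V j - V l)\<^sup>2) = (V j)\<^sup>2 - (2 * ?m) * V j + ?s" for j
  proof -
    have "(\<lambda>l. (V j - V l)\<^sup>2) = (\<lambda>l. ((V j)\<^sup>2 - (2 * V j) * V l) + (V l)\<^sup>2)"
      by (rule ext) (simp add: power2_diff)
    then show ?thesis using ia by (simp only: mean_add mean_diff mean_cmult mean_const) simp
  qed
  then have "mean2 i a (\<lambda>j l. (V j - V l)\<^sup>2) = ?s - (2 * ?m) * ?m + ?s"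
    using ia by (simp only: mean_add mean_diff mean_cmult mean_const)
  then show ?thesis by (simp add: variance_def power2_eq_square)
qed

lemma mean2_pair_stat:
  assumes ia: "i < nS D" "a < nA D"
  shows "mean2 i a (pair_stat \<eta> V) = mean i a V - \<eta> * variance i a V"
proof -
  have "pair_stat \<eta> V = (\<lambda>j l. V j - \<eta> / 2 * (V j - V l)\<^sup>2)"
    by (simp add: fun_eq_iff pair_stat_def power2_eq_square)
  then have "mean2 i a (pair_stat \<eta> V) = mean2 i a (\<lambda>j l. V j - \<eta> / 2 * (V j - V l)\<^sup>2)"
    by simp
  also have "\<dots> = mean i a V - \<eta> / 2 * (2 * variance i a V)"
    using ia by (simp only: mean_diff mean_cmult mean_const mean2_square_diff)
  finally show ?thesis by simp
qed

lemma mean2_mono: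
  assumes "i < nS D" "a < nA D"
    "\<And>j l. j < nS D \<Longrightarrow> l < nS D \<Longrightarrow> h j l \<le> h' j l"
  shows "mean2 i a h \<le> mean2 i a h'"
  using assms by (intro mean_mono) auto

text \<open>With d = V j - V l, the bound (x - y)^2 <= 2 x^2 + 2 y^2 leaves 2 (\<eta>/2 d^2)^2 <=
  d^2/2, as |\<eta> d| <= 1. The means of 2 x^2 and d^2/2 are 2 Var and Var.\<close>

lemma mean2_pair_stat_square:
  assumes ia: "i < nS D" "a < nA D" and V: "\<And>j. j < nS D \<Longrightarrow> 0 \<le> V j \<and> V j \<le> R"
    and \<eta>: "0 \<le> \<eta>" "\<eta> * R \<le> 1"
  shows "mean2 i a (\<lambda>j l. (pair_stat \<eta> V j l - mean i a V)\<^sup>2) \<le> 3 * variance i a V"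
proof -
  let ?m = "mean i a V"
  have "(pair_stat \<eta> V j l - ?m)\<^sup>2 \<le> 2 * (V j - ?m)\<^sup>2 + (1 / 2) * (V j - V l)\<^sup>2"
    if "j < nS D" "l < nS D" for j l
  proof -
    let ?d = "V j - V l"
    have "\<bar>?d\<bar> \<le> R" using V[OF that(1)] V[OF that(2)] by (auto simp: abs_le_iff)
    then have "\<bar>\<eta> * ?d\<bar> \<le> 1"
      using \<eta> mult_left_mono[of "\<bar>?d\<bar>" R \<eta>] by (simp add: abs_mult)
    then have "(\<eta> * ?d)\<^sup>2 \<le> 1" by (simp add: abs_square_le_1)
    then have "(\<eta> * ?d)\<^sup>2 * ?d\<^sup>2 \<le> 1 * ?d\<^sup>2" by (intro mult_right_mono) auto
    moreover have "(pair_stat \<eta> V j l - ?m)\<^sup>2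
        \<le> 2 * (V j - ?m)\<^sup>2 + 2 * (\<eta> / 2 * (?d * ?d))\<^sup>2"
      using zero_le_power2[of "V j - ?m + \<eta> / 2 * (?d * ?d)"]
      by (simp add: pair_stat_def power2_eq_square algebra_simps)
    ultimately show ?thesis by (simp add: power2_eq_square mult_ac)
  qed
  then have "mean2 i a (\<lambda>j l. (pair_stat \<eta> V j l - ?m)\<^sup>2)
      \<le> mean2 i a (\<lambda>j l. 2 * (V j - ?m)\<^sup>2 + (1 / 2) * (V j - V l)\<^sup>2)"
    by (intro mean2_mono ia)
  also have "\<dots> = 2 * variance i a V + (1 / 2) * (2 * variance i a V)"
    using ia by (simp only: mean_add mean_cmult mean_const mean2_square_diff variance_eq)
  finally show ?thesis by simp
qed

text \<open>The scale makes the second-order term 3 (\<eta>/3)^2 Var equal to \<eta>/3 times the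
  penalty \<eta> Var. In the upper tail the two cancel. In the lower tail they add up to 2 \<eta>
  Var, which the shift in the exponent removes by 1 + x <= exp x.\<close>

lemma pair_stat_exp_moments:
  assumes ia: "i < nS D" "a < nA D" and V: "\<And>j. j < nS D \<Longrightarrow> 0 \<le> V j \<and> V j \<le> R"
    and \<eta>: "0 \<le> \<eta>" "\<eta> * R \<le> 1"
  shows "mean2 i a (\<lambda>j l. exp (\<eta> / 3 * (pair_stat \<eta> V j l - mean i a V))) \<le> 1"
    and "mean2 i a (\<lambda>j l. exp (\<eta> / 3 * (mean i a V - 2 * \<eta> * variance i a V - pair_stat \<eta> V j l))) \<le> 1"
proof -
  let ?m = "mean i a V" and ?v = "variance i a V"
  let ?z = "\<lambda>j l. pair_stat \<eta> V j l - ?m"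
  have m: "0 \<le> ?m" "?m \<le> R" using mean_bounds[OF ia, of 0 V R] V by auto
  have small: "\<bar>\<eta> / 3 * ?z j l\<bar> \<le> 1" if "j < nS D" "l < nS D" for j l
  proof -
    let ?d = "V j - V l"
    have d: "\<bar>?d\<bar> \<le> R" using V[OF that(1)] V[OF that(2)] by (auto simp: abs_le_iff)
    have "\<bar>\<eta> * ?d\<bar> \<le> 1"
      using \<eta> d mult_left_mono[of "\<bar>?d\<bar>" R \<eta>] by (simp add: abs_mult)
    then have "\<bar>\<eta> * ?d\<bar> * \<bar>?d\<bar> \<le> 1 * R" using d by (intro mult_mono) auto
    then have "\<bar>\<eta> / 2 * (?d * ?d)\<bar> \<le> R / 2" by (simp add: abs_mult mult_ac)
    moreover have "\<bar>V j - ?m\<bar> \<le> R" using V[OF that(1)] m by (auto simp: abs_le_iff)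
    ultimately have "\<bar>?z j l\<bar> \<le> 3 * R" using R_pos unfolding pair_stat_def by linarith
    then have "\<eta> / 3 * \<bar>?z j l\<bar> \<le> \<eta> / 3 * (3 * R)" using \<eta> by (intro mult_left_mono) auto
    then show ?thesis using \<eta> by (simp add: abs_mult)
  qed
  have moment: "mean2 i a (\<lambda>j l. exp (\<eta> / 3 * (\<sigma> * ?z j l))) \<le> 1 - \<eta> / 3 * \<sigma> * (\<eta> * ?v) + \<eta> / 3 * (\<eta> * ?v)"
    if \<sigma>: "\<sigma> = 1 \<or> \<sigma> = -1" for \<sigma> :: real
  proof -
    have "mean2 i a (\<lambda>j l. exp (\<eta> / 3 * (\<sigma> * ?z j l)))
      \<le> mean2 i a (\<lambda>j l. 1 + (\<eta> / 3 * \<sigma>) * (pair_stat \<eta> V j l - ?m) + (\<eta> / 3)\<^sup>2 * (?z j l)\<^sup>2)"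
    proof (intro mean2_mono ia)
      fix j l assume "j < nS D" "l < nS D"
      then have "exp (\<eta> / 3 * (\<sigma> * ?z j l)) \<le> 1 + \<eta> / 3 * (\<sigma> * ?z j l) + (\<eta> / 3 * (\<sigma> * ?z j l))\<^sup>2"
        using small \<sigma> by (intro exp_le_quadratic) (auto simp: abs_mult)
      also have "(\<eta> / 3 * (\<sigma> * ?z j l))\<^sup>2 = (\<eta> / 3)\<^sup>2 * (?z j l)\<^sup>2"
        using \<sigma> by (auto simp: power_mult_distrib power_divide power2_commute)
      finally show "exp (\<eta> / 3 * (\<sigma> * ?z j l)) \<le> 1 + (\<eta> / 3 * \<sigma>) * ?z j l + (\<eta> / 3)\<^sup>2 * (?z j l)\<^sup>2"
        by (simp only: mult.assoc)
    qed
    also have "\<dots> = 1 + (\<eta> / 3 * \<sigma>) * (?m - \<eta> * ?v - ?m) + (\<eta> / 3)\<^sup>2 * mean2 i a (\<lambda>j l. (?z j l)\<^sup>2)"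
      using ia by (simp only: mean_add mean_diff mean_cmult mean_const mean2_pair_stat)
    also have "\<dots> \<le> 1 + (\<eta> / 3 * \<sigma>) * (?m - \<eta> * ?v - ?m) + (\<eta> / 3)\<^sup>2 * (3 * ?v)"
      using mean2_pair_stat_square[OF ia V \<eta>] by (intro add_left_mono mult_left_mono) auto
    finally show ?thesis by (simp add: power2_eq_square algebra_simps)
  qed
  show "mean2 i a (\<lambda>j l. exp (\<eta> / 3 * (pair_stat \<eta> V j l - ?m))) \<le> 1"
    using moment[of 1] by simp
  have "mean2 i a (\<lambda>j l. exp (\<eta> / 3 * (?m - 2 * \<eta> * ?v - pair_stat \<eta> V j l)))
    = mean2 i a (\<lambda>j l. exp (- (2 * (\<eta> / 3 * (\<eta> * ?v)))) * exp (\<eta> / 3 * (-1 * ?z j l)))"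
    by (simp add: algebra_simps flip: exp_add)
  also have "\<dots> = exp (- (2 * (\<eta> / 3 * (\<eta> * ?v)))) * mean2 i a (\<lambda>j l. exp (\<eta> / 3 * (-1 * ?z j l)))"
    by (simp only: mean_cmult)
  also have "mean2 i a (\<lambda>j l. exp (\<eta> / 3 * (-1 * ?z j l))) \<le> 1 + 2 * (\<eta> / 3 * (\<eta> * ?v))"
    using moment[of "-1"] by simp
  also have "\<dots> \<le> exp (2 * (\<eta> / 3 * (\<eta> * ?v)))"
    by (rule exp_ge_add_one_self)
  finally show "mean2 i a (\<lambda>j l. exp (\<eta> / 3 * (?m - 2 * \<eta> * ?v - pair_stat \<eta> V j l))) \<le> 1"
    by (simp add: mult_left_mono flip: exp_add)
qed

lemma nn_integral_trans:
  assumes ia: "i < nS D" "a < nA D" and h: "\<And>j. 0 \<le> h j"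
  shows "(\<integral>\<^sup>+ j. ennreal (h j) \<partial>measure_pmf (trans D i a)) = ennreal (mean i a h)"
proof -
  have "(\<integral>\<^sup>+ j. ennreal (h j) \<partial>measure_pmf (trans D i a))
      = (\<Sum>j<nS D. ennreal (h j) * pmf (trans D i a) j)"
    by (intro nn_integral_measure_pmf_support) (use set_trans[OF ia] in auto)
  also have "\<dots> = ennreal (mean i a h)"
    by (simp add: mean_def h sum_ennreal mult.commute flip: ennreal_mult)
  finally show ?thesis .
qed

end

section \<open>Weakest preexpectations\<close>

text \<open>\<open>None\<close> counts as infinity, so a finite bound entails almost sure
  termination, and one transformer serves for \<open>expected_time\<close> and for failure
  probabilities.\<close>

definition ewp :: "'s spmf \<Rightarrow> ('s \<Rightarrow> ennreal) \<Rightarrow> ennreal" where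
  "ewp p f = (\<integral>\<^sup>+ x. (case x of None \<Rightarrow> \<infinity> | Some s \<Rightarrow> f s) \<partial>measure_pmf p)"

lemma ewp_return [simp]: "ewp (return_spmf s) f = f s"
  by (simp add: ewp_def)

lemma ewp_map [simp]: "ewp (map_spmf g p) f = ewp p (\<lambda>s. f (g s))"
  unfolding ewp_def by (auto simp: nn_integral_map_pmf intro!: nn_integral_cong split: option.split)

lemma ewp_bind [simp]: "ewp (bind_spmf p h) f = ewp p (\<lambda>s. ewp (h s) f)"
  unfolding ewp_def bind_spmf_def
  by (auto simp: nn_integral_bind_pmf intro!: nn_integral_cong split: option.split)

lemma ewp_spmf_of_pmf [simp]: "ewp (spmf_of_pmf q) f = (\<integral>\<^sup>+ x. f x \<partial>measure_pmf q)"
  unfolding ewp_def spmf_of_pmf_def by (simp add: nn_integral_map_pmf)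

lemma ewp_mono: "(\<And>s. f s \<le> g s) \<Longrightarrow> ewp p f \<le> ewp p g"
  unfolding ewp_def by (auto intro!: nn_integral_mono split: option.split)

text \<open>Induction on the rank suffices: an outcome that fails to lower it is charged infinity,
  hence has probability zero wherever \<open>I\<close> is finite. Invariants are encoded likewise,
  with \<open>I\<close> infinite on states that violate them, where both premises are
  trivial.\<close>

lemma ewp_loop:
  assumes step: "\<And>t. b t \<Longrightarrow> ewp (body t) (\<lambda>u. if m u < (m t :: nat) then I u else \<infinity>) \<le> I t"
    and exit: "\<And>t. \<not> b t \<Longrightarrow> f t \<le> I t"
  shows "ewp (loop b body s) f \<le> I s"
proof (induction s rule: measure_induct_rule[of m])
  case (less s)
  show ?case
  proof (cases "b s")
    case True
    then have "ewp (loop b body s) f = ewp (body s) (\<lambda>u. ewp (loop b body u) f)"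
      by (subst loop.simps) simp
    also have "\<dots> \<le> ewp (body s) (\<lambda>u. if m u < m s then I u else \<infinity>)"
      using less by (intro ewp_mono) auto
    finally show ?thesis using step[OF True] by simp
  next
    case False
    then show ?thesis using exit[of s] by (subst loop.simps) simp
  qed
qed

lemma memory_simps [simp]:
  "imem (tick n s) = imem s" "rmem (tick n s) = rmem s"
  "steps (tick n s) = steps s + n" "orc_time (tick n s) = orc_time s"
  "imem (iput x i j z s) = (imem s)(x := (imem s x)(i := (imem s x i)(j := z)))"
  "rmem (iput x i j z s) = rmem s" "steps (iput x i j z s) = steps s"
  "orc_time (iput x i j z s) = orc_time s"
  "rmem (rput x i j v s) = (rmem s)(x := (rmem s x)(i := (rmem s x i)(j := v)))"
  "imem (rput x i j v s) = imem s" "steps (rput x i j v s) = steps s"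
  "orc_time (rput x i j v s) = orc_time s"
  by (simp_all add: tick_def iput_def rput_def)

section \<open>The program\<close>

notation Seq (infixr ";;" 60)

abbreviation "ivar x \<equiv> IGet x (ILit 0) (ILit 0)"
abbreviation "rvar x \<equiv> RGet x (ILit 0) (ILit 0)"
abbreviation "rlit n \<equiv> OfNat (ILit n)"
abbreviation "iassign x e \<equiv> ISet x (ILit 0) (ILit 0) e"
abbreviation "rassign x e \<equiv> RSet x (ILit 0) (ILit 0) e"

text \<open>Leaves in \<open>l\<close> the least \<open>l\<close> with \<open>X \<le> 2 ^ l\<close>, in place of a logarithm.\<close>

definition doubling :: com where
  "doubling =
     rassign ''p'' (rlit 1) ;; rassign ''l'' (rlit 0) ;;
     While (RLess (rvar ''p'') (rvar ''X''))
       (rassign ''p'' (RAdd (rvar ''p'') (rvar ''p'')) ;;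
        rassign ''l'' (RAdd (rvar ''l'') (rlit 1)))"

definition set_horizon :: com where
  "set_horizon =
     rassign ''H'' (RDiv (rlit 1) (RSub (rlit 1) (rvar ''gamma''))) ;;
     rassign ''R'' (RMul (RMul (rlit 2) (rvar ''H'')) (rvar ''M'')) ;;
     rassign ''X'' (RDiv (RMul (rlit 2) (rvar ''R'')) (rvar ''eps''))"

text \<open>\<open>H * l\<close> sweeps contract by exp (-l). The new \<open>X\<close> bounds the
  number of updates, times two tails, divided by \<delta>; its logarithm is the exponent demanded of
  every tail bound.\<close>

definition set_sweeps :: com where
  "set_sweeps =
     rassign ''K'' (RMul (rvar ''H'') (rvar ''l'')) ;;
     rassign ''X'' (RDiv (RMul (RMul (rlit 2) (RMul (OfNat (ivar ''S'')) (OfNat (ivar ''A''))))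
       (RAdd (rvar ''K'') (rlit 1))) (rvar ''delta''))"

text \<open>\<open>N\<close> is 3 l / (\<eta> \<beta>), with 1536 = 3 * 32 * 16, and
  \<open>l\<close> is here the result of the second doubling. \<open>N\<close> stays a real number;
  comparing a counter with it in the guard rounds it up.\<close>

definition set_precision :: com where
  "set_precision =
     rassign ''N'' (RDiv (RMul (RMul (RMul (rlit 1536) (rvar ''l'')) (RMul (rvar ''R'') (rvar ''R''))) (rvar ''H''))
       (RMul (rvar ''eps'') (rvar ''eps''))) ;;
     rassign ''eta'' (RDiv (rvar ''eps'') (RMul (rlit 32) (RMul (rvar ''R'') (rvar ''R'')))) ;;
     rassign ''beta'' (RDiv (rvar ''eps'') (RMul (rlit 16) (rvar ''H'')))"

definition parameters :: com where
  "parameters = set_horizon ;; doubling ;; set_sweeps ;; doubling ;; set_precision"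

definition draw_pair :: com where
  "draw_pair =
     Sample ''x'' (ivar ''i'') (ivar ''a'') ;; Sample ''y'' (ivar ''i'') (ivar ''a'') ;;
     rassign ''sum'' (RAdd (rvar ''sum'')
       (RSub (RGet ''v'' (ivar ''x'') (ILit 0))
         (RMul (RDiv (rvar ''eta'') (rlit 2))
           (RMul (RSub (RGet ''v'' (ivar ''x'') (ILit 0)) (RGet ''v'' (ivar ''y'') (ILit 0)))
                 (RSub (RGet ''v'' (ivar ''x'') (ILit 0)) (RGet ''v'' (ivar ''y'') (ILit 0))))))) ;;
     iassign ''n'' (IAdd (ivar ''n'') (ILit 1))"

definition estimate :: com where
  "estimate =
     rassign ''sum'' (rlit 0) ;; iassign ''n'' (ILit 0) ;;
     While (RLess (OfNat (ivar ''n'')) (rvar ''N'')) draw_pair"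

text \<open>The divisor is the counter \<open>n\<close>, since the number of pairs drawn is the
  ceiling of \<open>N\<close>. Writing \<open>v\<close> and \<open>pi\<close> together is what keeps
  V <= T_\<pi> V.\<close>

definition improve :: com where
  "improve =
     rassign ''q'' (RAdd (RAdd (RGet ''r'' (ivar ''i'') (ivar ''a'')) (rvar ''M''))
       (RMul (rvar ''gamma'') (RSub (RDiv (rvar ''sum'') (OfNat (ivar ''n''))) (rvar ''beta'')))) ;;
     Cond (RLess (RGet ''v'' (ivar ''i'') (ILit 0)) (rvar ''q''))
       (RSet ''v'' (ivar ''i'') (ILit 0) (rvar ''q'') ;; ISet ''pi'' (ivar ''i'') (ILit 0) (ivar ''a''))
       Skip"

text \<open>The loops over sweeps, states and actions are flattened into one, so that one invariant
  and one rank cover all three.\<close>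

definition advance :: com where
  "advance =
     iassign ''a'' (IAdd (ivar ''a'') (ILit 1)) ;;
     Cond (ILess (ivar ''a'') (ivar ''A'')) Skip
       (iassign ''a'' (ILit 0) ;; iassign ''i'' (IAdd (ivar ''i'') (ILit 1)) ;;
        Cond (ILess (ivar ''i'') (ivar ''S'')) Skip
          (iassign ''i'' (ILit 0) ;; iassign ''k'' (IAdd (ivar ''k'') (ILit 1))))"

definition sweeps :: com where
  "sweeps = While (RLess (OfNat (ivar ''k'')) (rvar ''K'')) (estimate ;; improve ;; advance)"

text \<open>For \<open>\<epsilon> \<ge> 2M/(1-\<gamma>)\<close> every policy is \<open>\<epsilon>\<close>-optimal, in particular the one given by
  the initial zeros.\<close>

definition solver :: com where
  "solver = Cond (RLess (rvar ''eps'')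
       (RMul (RMul (rlit 2) (RDiv (rlit 1) (RSub (rlit 1) (rvar ''gamma'')))) (rvar ''M'')))
     (parameters ;; sweeps) Skip"

section \<open>Preexpectation rules for the program\<close>

lemma ewp_While:
  assumes "\<And>t. bval b t \<Longrightarrow>
      ewp (exec orc c (tick (1 + bcost b) t)) (\<lambda>u. if m u < (m t :: nat) then I u else \<infinity>) \<le> I t"
    and "\<And>t. \<not> bval b t \<Longrightarrow> f (tick (1 + bcost b) t) \<le> I t"
  shows "ewp (exec orc (While b c) s) f \<le> I s"
  using assms unfolding exec.simps ewp_map by (rule ewp_loop)

lemma ewp_exec [simp]:
  "ewp (exec orc Skip s) g = g (tick 1 s)"
  "ewp (exec orc (ISet x e f h) s) g =
     g (tick (1 + icost e + icost f + icost h) (iput x (ival e s) (ival f s) (ival h s) s))"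
  "ewp (exec orc (RSet x e f r) s) g =
     g (tick (1 + icost e + icost f + rcost r) (rput x (ival e s) (ival f s) (rval r s) s))"
  "ewp (exec orc (Sample x e f) s) g =
     (\<integral>\<^sup>+ y. g (tick (1 + icost e + icost f) ((iput x 0 0 (fst y) s)\<lparr>orc_time := orc_time s + snd y\<rparr>))
       \<partial>measure_pmf (orc (ival e s) (ival f s)))"
  "ewp (exec orc (c ;; d) s) g = ewp (exec orc c s) (\<lambda>t. ewp (exec orc d t) g)"
  "ewp (exec orc (Cond b c d) s) g =
     (if bval b s then ewp (exec orc c (tick (1 + bcost b) s)) g
      else ewp (exec orc d (tick (1 + bcost b) s)) g)"
  unfolding exec.simps ewp_return ewp_map ewp_bind ewp_spmf_of_pmf
  by (simp_all add: case_prod_unfold)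

declare exec.simps [simp del]

text \<open>The alternative \<open>n = 0\<close> or \<open>2 ^ n < 2 * X\<close> records that the
  loop stopped as early as possible; it later bounds the logarithms in the running time. The loop
  ends because \<open>p\<close> is at least 1, so doubling it lowers the ceiling of
  \<open>X - p\<close>.\<close>

lemma ewp_doubling:
  assumes post: "\<And>t n. \<lbrakk>imem t = imem s; \<And>z. z \<noteq> ''p'' \<Longrightarrow> z \<noteq> ''l'' \<Longrightarrow> rmem t z = rmem s z;
      rmem t ''l'' 0 0 = real n; rmem s ''X'' 0 0 \<le> 2 ^ n; n = 0 \<or> 2 ^ n < 2 * rmem s ''X'' 0 0;
      orc_time t = orc_time s; steps t \<le> steps s + 50 * (n + 1)\<rbrakk> \<Longrightarrow> f t \<le> F"
  shows "ewp (exec orc doubling s) f \<le> F"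
proof -
  define X where "X = rmem s ''X'' 0 0"
  define inv where "inv t \<longleftrightarrow> imem t = imem s \<and> (\<forall>z. z \<noteq> ''p'' \<longrightarrow> z \<noteq> ''l'' \<longrightarrow> rmem t z = rmem s z) \<and>
     orc_time t = orc_time s \<and> (\<exists>n. rmem t ''l'' 0 0 = real n \<and> rmem t ''p'' 0 0 = 2 ^ n \<and>
       (n = 0 \<or> 2 ^ n < 2 * X) \<and> steps t \<le> steps s + 50 * n + 20)" for t :: state
  define I where "I t = (if inv t then F else \<infinity>)" for t
  have invI: "inv t" if "imem t = imem s" "\<And>z. z \<noteq> ''p'' \<Longrightarrow> z \<noteq> ''l'' \<Longrightarrow> rmem t z = rmem s z"
    "orc_time t = orc_time s" "rmem t ''l'' 0 0 = real n" "rmem t ''p'' 0 0 = 2 ^ n"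
    "n = 0 \<or> 2 ^ n < 2 * X" "steps t \<le> steps s + 50 * n + 20" for t n
    using that unfolding inv_def by blast
  have X: "rmem t ''X'' 0 0 = X" if "inv t" for t
    using that by (simp add: inv_def X_def)
  let ?b = "RLess (rvar ''p'') (rvar ''X'')"
  let ?c = "rassign ''p'' (RAdd (rvar ''p'') (rvar ''p'')) ;;
        rassign ''l'' (RAdd (rvar ''l'') (rlit 1))"
  have loop: "ewp (exec orc (While ?b ?c) t) f \<le> I t" for t
  proof (rule ewp_While[where m = "\<lambda>t. nat \<lceil>X - rmem t ''p'' 0 0\<rceil>"])
    fix t :: state assume b: "bval ?b t"
    show "ewp (exec orc ?c (tick (1 + bcost ?b) t))
        (\<lambda>u. if nat \<lceil>X - rmem u ''p'' 0 0\<rceil> < nat \<lceil>X - rmem t ''p'' 0 0\<rceil> then I u else \<infinity>) \<le> I t"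
    proof (cases "inv t")
      case True
      then obtain n where n: "rmem t ''l'' 0 0 = real n" "rmem t ''p'' 0 0 = 2 ^ n"
          "steps t \<le> steps s + 50 * n + 20"
        unfolding inv_def by blast
      have lt: "2 ^ n < X" using b X[OF True] n by simp
      have "(1::real) \<le> 2 ^ n" by simp
      then have "\<lceil>X - 2 * 2 ^ n\<rceil> < \<lceil>X - 2 ^ n\<rceil>" "0 < \<lceil>X - 2 ^ n\<rceil>"
        using lt by linarith+
      then have rank: "nat \<lceil>X - 2 * 2 ^ n\<rceil> < nat \<lceil>X - 2 ^ n\<rceil>" by linarith
      have step: "inv u" if "imem u = imem t" "\<And>z. z \<noteq> ''p'' \<Longrightarrow> z \<noteq> ''l'' \<Longrightarrow> rmem u z = rmem t z"
        "orc_time u = orc_time t" "rmem u ''l'' 0 0 = real n + 1" "rmem u ''p'' 0 0 = 2 * 2 ^ n"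
        "steps u \<le> steps t + 50" for u
        using that True n lt by (intro invI[of _ "Suc n"]) (simp_all add: inv_def)
      show ?thesis
        using rank True n by (simp del: One_nat_def add: I_def step)
    qed (simp add: I_def)
  next
    fix t :: state assume b: "\<not> bval ?b t"
    show "f (tick (1 + bcost ?b) t) \<le> I t"
    proof (cases "inv t")
      case True
      then obtain n where n: "rmem t ''l'' 0 0 = real n" "rmem t ''p'' 0 0 = 2 ^ n"
          "n = 0 \<or> 2 ^ n < 2 * X" "steps t \<le> steps s + 50 * n + 20"
        unfolding inv_def by blast
      have "rmem s ''X'' 0 0 \<le> 2 ^ n" using b n X[OF True] by (simp add: X_def)
      then have "f (tick (1 + bcost ?b) t) \<le> F"
        using True n by (intro post[of _ n]) (simp_all add: inv_def X_def)
      then show ?thesis using True by (simp add: I_def)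
    qed (simp add: I_def)
  qed
  have init: "I u \<le> F" if "imem u = imem s" "\<And>z. z \<noteq> ''p'' \<Longrightarrow> z \<noteq> ''l'' \<Longrightarrow> rmem u z = rmem s z"
    "orc_time u = orc_time s" "rmem u ''l'' 0 0 = 0" "rmem u ''p'' 0 0 = 1"
    "steps u \<le> steps s + 20" for u
    using that invI[of u 0] by (simp add: I_def)
  show ?thesis
    unfolding doubling_def
    by (simp del: One_nat_def) (rule order_trans[OF loop init]; simp del: One_nat_def)
qed

context discounted_mdp
begin

text \<open>Time and sample may be correlated, but they enter different summands, so linearity needs
  only the two marginals. The case \<open>A2 = 0\<close> is for states where the invariant has
  failed: no moment bound is available there, yet time still has to be counted.\<close>

lemma nn_integral_oracle:
  assumes orc: "sampling_oracle D \<kappa> orc" and ia: "i < nS D" "a < nA D"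
    and h: "\<And>j l. 0 \<le> h j l" and A2: "A2 = 0 \<or> mean2 i a h \<le> B"
  shows "(\<integral>\<^sup>+ x. \<integral>\<^sup>+ y. A1 + A2 * ennreal (h (fst x) (fst y)) + b * of_nat (c + snd x + snd y)
      \<partial>measure_pmf (orc i a) \<partial>measure_pmf (orc i a))
    \<le> A1 + A2 * ennreal B + b * (of_nat c + 2 * ennreal \<kappa>)"
proof -
  let ?q = "measure_pmf (orc i a)"
  have fst: "(\<integral>\<^sup>+ x. ennreal (g (fst x)) \<partial>?q) = ennreal (mean i a g)" if "\<And>j. 0 \<le> g j" for g
  proof -
    have "map_pmf fst (orc i a) = trans D i a"
      using orc ia by (simp add: sampling_oracle_def)
    then show ?thesis
      using nn_integral_trans[OF ia that] nn_integral_map_pmf[of fst "orc i a" "\<lambda>j. ennreal (g j)"] by simp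
  qed
  have nonneg: "0 \<le> mean i a (h j)" for j
    unfolding mean_def by (intro sum_nonneg mult_nonneg_nonneg) (simp_all add: h)
  have time: "(\<integral>\<^sup>+ x. of_nat (snd x) \<partial>?q) \<le> ennreal \<kappa>"
    using orc ia by (simp add: sampling_oracle_def)
  have "(\<integral>\<^sup>+ x. \<integral>\<^sup>+ y. A1 + A2 * ennreal (h (fst x) (fst y)) + b * of_nat (c + snd x + snd y) \<partial>?q \<partial>?q)
    = A1 + A2 * ennreal (mean2 i a h) + b * (of_nat c + (\<integral>\<^sup>+ x. of_nat (snd x) \<partial>?q) + (\<integral>\<^sup>+ x. of_nat (snd x) \<partial>?q))"
    by (simp add: nn_integral_add nn_integral_cmult fst fst[of "\<lambda>j. mean i a (h j)"] h nonneg measure_pmf.emeasure_space_1 distrib_left add_ac)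
  also have "\<dots> \<le> A1 + A2 * ennreal B + b * (of_nat c + ennreal \<kappa> + ennreal \<kappa>)"
    using A2 by (intro add_mono mult_left_mono[of _ _ b] order_refl time)
      (auto intro: mult_left_mono ennreal_leI)
  finally show ?thesis by (simp add: mult_2 add_ac)
qed

end

section \<open>Estimating a backup\<close>

definition agree :: "state \<Rightarrow> state \<Rightarrow> bool" where
  "agree s t \<longleftrightarrow> (\<forall>z. z \<notin> {''n'', ''x'', ''y''} \<longrightarrow> imem t z = imem s z) \<and>
     (\<forall>z. z \<noteq> ''sum'' \<longrightarrow> rmem t z = rmem s z)"

context discounted_mdp
begin

lemma ewp_draw_pair:
  assumes V: "V = (\<lambda>j. rmem s ''v'' j 0)" and \<eta>: "rmem s ''eta'' 0 0 = \<eta>"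
    and ia: "imem s ''i'' 0 0 = i" "imem s ''a'' 0 0 = a"
    and post: "\<And>u j l t1 t2. \<lbrakk>agree s u; imem u ''n'' 0 0 = Suc (imem s ''n'' 0 0);
        rmem u ''sum'' 0 0 = rmem s ''sum'' 0 0 + pair_stat \<eta> V j l;
        orc_time u = orc_time s + t1 + t2; steps u \<le> steps s + 80\<rbrakk> \<Longrightarrow> g u \<le> G j l t1 t2"
  shows "ewp (exec orc draw_pair s) g
    \<le> (\<integral>\<^sup>+ x. \<integral>\<^sup>+ y. G (fst x) (fst y) (snd x) (snd y) \<partial>measure_pmf (orc i a) \<partial>measure_pmf (orc i a))"
  unfolding draw_pair_def
  by (simp add: ia del: One_nat_def)
    (intro nn_integral_mono post; simp add: agree_def pair_stat_def V \<eta> del: One_nat_def)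

text \<open>For fixed \<open>V\<close> the two exponentials are supermartingales in the number of
  pairs, since each pair multiplies them by a factor of mean at most 1. Both start at 1, whence the
  2. Each remaining pair adds two oracle calls to the time.\<close>

lemma ewp_estimate:
  fixes s :: state and N \<eta> :: real and A1 A2 b :: ennreal
  assumes orc: "sampling_oracle D \<kappa> orc"
    and ia: "imem s ''i'' 0 0 = i" "imem s ''a'' 0 0 = a" "i < nS D" "a < nA D"
    and \<eta>: "rmem s ''eta'' 0 0 = \<eta>" "0 \<le> \<eta>" "\<eta> * R \<le> 1" and N: "rmem s ''N'' 0 0 = N"
    and V: "V = (\<lambda>j. rmem s ''v'' j 0)" "A2 = 0 \<or> (\<forall>j<nS D. 0 \<le> V j \<and> V j \<le> R)"
    and post: "\<And>t. \<lbrakk>agree s t; imem t ''n'' 0 0 = nat \<lceil>N\<rceil>; steps t \<le> steps s + 100 * (nat \<lceil>N\<rceil> + 1)\<rbrakk> \<Longrightarrow>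
       f t \<le> A1 + A2 * ennreal (exp (\<eta> / 3 * (rmem t ''sum'' 0 0 - nat \<lceil>N\<rceil> * mean i a V))
           + exp (\<eta> / 3 * (nat \<lceil>N\<rceil> * (mean i a V - 2 * \<eta> * variance i a V) - rmem t ''sum'' 0 0)))
         + b * of_nat (orc_time t)"
  shows "ewp (exec orc estimate s) f
    \<le> A1 + A2 * 2 + b * (of_nat (orc_time s) + ennreal \<kappa> * of_nat (2 * nat \<lceil>N\<rceil>))"
proof -
  let ?m = "mean i a V" and ?lo = "mean i a V - 2 * \<eta> * variance i a V"
  define Nn where "Nn = nat \<lceil>N\<rceil>"
  define e1 where "e1 S n = exp (\<eta> / 3 * (S - real n * ?m))" for S n
  define e2 where "e2 S n = exp (\<eta> / 3 * (real n * ?lo - S))" for S n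
  define inv where "inv t \<longleftrightarrow> agree s t \<and> imem t ''n'' 0 0 \<le> Nn \<and>
    steps t \<le> steps s + 100 * imem t ''n'' 0 0 + 50" for t :: state
  define P where "P n S \<tau> = A1 + A2 * ennreal (e1 S n + e2 S n) + b * (\<tau> + ennreal \<kappa> * of_nat (2 * (Nn - n)))"
    for n S \<tau>
  define I where "I t = (if inv t then P (imem t ''n'' 0 0) (rmem t ''sum'' 0 0) (of_nat (orc_time t)) else \<infinity>)"
    for t :: state
  let ?b = "RLess (OfNat (ivar ''n'')) (rvar ''N'')"
  have loop: "ewp (exec orc (While ?b draw_pair) t) f \<le> I t" for t
  proof (rule ewp_While[where m = "\<lambda>t. Nn - imem t ''n'' 0 0"])
    fix t :: state assume b: "bval ?b t"
    show "ewp (exec orc draw_pair (tick (1 + bcost ?b) t))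
       (\<lambda>u. if Nn - imem u ''n'' 0 0 < Nn - imem t ''n'' 0 0 then I u else \<infinity>) \<le> I t"
    proof (cases "inv t")
      case True
      define n where "n = imem t ''n'' 0 0"
      define S where "S = rmem t ''sum'' 0 0"
      let ?t = "tick (1 + bcost ?b) t"
      have t: "agree s t" "steps t \<le> steps s + 100 * n + 50"
        using True by (auto simp: inv_def n_def)
      then have mem: "rmem t ''v'' = rmem s ''v''" "rmem t ''eta'' 0 0 = \<eta>"
        "imem t ''i'' 0 0 = i" "imem t ''a'' 0 0 = a" "rmem t ''N'' 0 0 = N"
        using ia \<eta> N by (auto simp: agree_def)
      have n: "n < Nn" using b mem by (simp add: n_def Nn_def) linarith
      define h where "h j l = e1 S n * exp (\<eta> / 3 * (pair_stat \<eta> V j l - ?m)) +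
        e2 S n * exp (\<eta> / 3 * (?lo - pair_stat \<eta> V j l))" for j l
      have h: "e1 (S + pair_stat \<eta> V j l) (Suc n) + e2 (S + pair_stat \<eta> V j l) (Suc n) = h j l" for j l
        by (simp add: h_def e1_def e2_def algebra_simps flip: exp_add)
      have "ewp (exec orc draw_pair ?t)
          (\<lambda>u. if Nn - imem u ''n'' 0 0 < Nn - imem t ''n'' 0 0 then I u else \<infinity>)
        \<le> (\<integral>\<^sup>+ x. \<integral>\<^sup>+ y. A1 + b * (ennreal \<kappa> * of_nat (2 * (Nn - Suc n))) + A2 * ennreal (h (fst x) (fst y))
            + b * of_nat (orc_time t + snd x + snd y) \<partial>measure_pmf (orc i a) \<partial>measure_pmf (orc i a))"
      proof (rule ewp_draw_pair[where V = V and \<eta> = \<eta> and i = i and a = a])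
        fix u :: state and j l t1 t2 :: nat
        assume u: "agree ?t u" "imem u ''n'' 0 0 = Suc (imem ?t ''n'' 0 0)"
          "rmem u ''sum'' 0 0 = rmem ?t ''sum'' 0 0 + pair_stat \<eta> V j l"
          "orc_time u = orc_time ?t + t1 + t2" "steps u \<le> steps ?t + 80"
        have "agree s u" using t(1) u(1) by (simp add: agree_def)
        then have "inv u" using t u n by (simp add: inv_def n_def[symmetric])
        then show "(if Nn - imem u ''n'' 0 0 < Nn - imem t ''n'' 0 0 then I u else \<infinity>)
          \<le> A1 + b * (ennreal \<kappa> * of_nat (2 * (Nn - Suc n))) + A2 * ennreal (h j l)
            + b * of_nat (orc_time t + t1 + t2)"
          using u n diff_less_mono2[of n "Suc n" Nn] by (simp add: I_def P_def n_def[symmetric] S_def[symmetric] h distrib_left add_ac)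
      qed (simp_all add: V(1) mem)
      also have "\<dots> \<le> A1 + b * (ennreal \<kappa> * of_nat (2 * (Nn - Suc n))) + A2 * ennreal (e1 S n + e2 S n)
          + b * (of_nat (orc_time t) + 2 * ennreal \<kappa>)"
      proof (rule nn_integral_oracle[OF orc ia(3,4)])
        show "0 \<le> h j l" for j l by (simp add: h_def e1_def e2_def)
        show "A2 = 0 \<or> mean2 i a h \<le> e1 S n + e2 S n"
        proof (cases "A2 = 0")
          case False
          then have range: "\<And>j. j < nS D \<Longrightarrow> 0 \<le> V j \<and> V j \<le> R" using V(2) by blast
          have "mean2 i a h = e1 S n * mean2 i a (\<lambda>j l. exp (\<eta> / 3 * (pair_stat \<eta> V j l - ?m))) +
              e2 S n * mean2 i a (\<lambda>j l. exp (\<eta> / 3 * (?lo - pair_stat \<eta> V j l)))"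
            unfolding h_def by (simp only: mean_add mean_cmult)
          also have "\<dots> \<le> e1 S n * 1 + e2 S n * 1"
            using pair_stat_exp_moments[OF ia(3,4) range \<eta>(2,3)]
            by (intro add_mono mult_left_mono) (auto simp: e1_def e2_def)
          finally show ?thesis by simp
        qed simp
      qed
      also have "\<dots> = P n S (of_nat (orc_time t))"
      proof -
        have "2 * (Nn - n) = 2 * (Nn - Suc n) + 2" using n by simp
        then show ?thesis by (simp add: P_def distrib_left add_ac mult_ac mult_2_right)
      qed
      finally show ?thesis using True by (simp add: I_def n_def S_def)
    qed (simp add: I_def)
  next
    fix t :: state assume b: "\<not> bval ?b t"
    show "f (tick (1 + bcost ?b) t) \<le> I t"
    proof (cases "inv t")
      case True
      then have "rmem t ''N'' 0 0 = N" using N by (simp add: inv_def agree_def)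
      then have n: "imem t ''n'' 0 0 = Nn"
        using b True by (simp add: Nn_def inv_def) linarith
      have "f (tick (1 + bcost ?b) t) \<le> A1 + A2 * ennreal (e1 (rmem t ''sum'' 0 0) Nn
           + e2 (rmem t ''sum'' 0 0) Nn) + b * of_nat (orc_time t)"
        using True n post[of "tick (1 + bcost ?b) t"]
        by (simp add: inv_def agree_def e1_def e2_def Nn_def)
      then show ?thesis using True n by (simp add: I_def P_def)
    qed (simp add: I_def)
  qed
  have init: "I u \<le> A1 + A2 * 2 + b * (of_nat (orc_time s) + ennreal \<kappa> * of_nat (2 * Nn))"
    if "agree s u" "imem u ''n'' 0 0 = 0" "rmem u ''sum'' 0 0 = 0" "orc_time u = orc_time s"
      "steps u \<le> steps s + 50" for u
    using that by (simp add: I_def P_def inv_def e1_def e2_def)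
  show ?thesis
    unfolding estimate_def Nn_def[symmetric]
    by (simp del: One_nat_def of_nat_mult)
      (rule order_trans[OF loop init]; simp add: agree_def del: One_nat_def)
qed

end

section \<open>The main loop\<close>

lemma ewp_improve:
  fixes s :: state and g :: "state \<Rightarrow> ennreal"
  assumes q: "q = rmem s ''r'' (imem s ''i'' 0 0) (imem s ''a'' 0 0) + rmem s ''M'' 0 0 +
      rmem s ''gamma'' 0 0 * (rmem s ''sum'' 0 0 / real (imem s ''n'' 0 0) - rmem s ''beta'' 0 0)"
    and i: "i = imem s ''i'' 0 0" and V: "V = (\<lambda>j. rmem s ''v'' j 0)"
    and post: "\<And>u. \<lbrakk>\<And>z. z \<noteq> ''q'' \<Longrightarrow> z \<noteq> ''v'' \<Longrightarrow> rmem u z = rmem s z; \<And>z. z \<noteq> ''pi'' \<Longrightarrow> imem u z = imem s z;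
        (\<lambda>j. rmem u ''v'' j 0) = (if V i < q then V(i := q) else V);
        output_policy u = (if V i < q then (output_policy s)(i := imem s ''a'' 0 0) else output_policy s);
        steps u \<le> steps s + 80; orc_time u = orc_time s\<rbrakk> \<Longrightarrow> g u \<le> F"
  shows "ewp (exec orc improve s) g \<le> F"
  unfolding improve_def
  by (auto simp: i V fun_eq_iff output_policy_def q simp del: One_nat_def intro!: post)

lemma ewp_advance:
  fixes s :: state and g :: "state \<Rightarrow> ennreal"
  assumes kia: "k = imem s ''k'' 0 0" "i = imem s ''i'' 0 0" "a = imem s ''a'' 0 0"
    and SA: "m = imem s ''S'' 0 0" "n = imem s ''A'' 0 0"
    and post: "\<And>u k' i' a'. \<lbrakk>rmem u = rmem s; \<And>z. z \<noteq> ''k'' \<Longrightarrow> z \<noteq> ''i'' \<Longrightarrow> z \<noteq> ''a'' \<Longrightarrow> imem u z = imem s z;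
        imem u ''k'' 0 0 = k'; imem u ''i'' 0 0 = i'; imem u ''a'' 0 0 = a';
        (k', i', a') = (if Suc a < n then (k, i, Suc a) else if Suc i < m then (k, Suc i, 0) else (Suc k, 0, 0));
        steps u \<le> steps s + 80; orc_time u = orc_time s\<rbrakk> \<Longrightarrow> g u \<le> F"
  shows "ewp (exec orc advance s) g \<le> F"
  unfolding advance_def
  by (auto simp: kia SA simp del: One_nat_def intro!: post)

context sampled_value_iteration
begin

text \<open>Index of the next update in the lexicographic order of sweep, state and action. It grows
  by one per iteration, so it measures progress, steps spent and risk left.\<close>

definition position :: "state \<Rightarrow> nat" where
  "position t = (imem t ''k'' 0 0 * nS D + imem t ''i'' 0 0) * nA D + imem t ''a'' 0 0"

definition good_state :: "state \<Rightarrow> bool" where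
  "good_state t \<longleftrightarrow> good (\<lambda>j. rmem t ''v'' j 0) (output_policy t)
     (imem t ''k'' 0 0) (imem t ''i'' 0 0) (imem t ''a'' 0 0)"

definition loaded :: "real \<Rightarrow> real \<Rightarrow> state \<Rightarrow> bool" where
  "loaded K N t \<longleftrightarrow> imem t ''S'' 0 0 = nS D \<and> imem t ''A'' 0 0 = nA D \<and>
     rmem t ''M'' 0 0 = M \<and> rmem t ''gamma'' 0 0 = \<gamma> \<and> rmem t ''eta'' 0 0 = \<eta> \<and> rmem t ''beta'' 0 0 = \<beta> \<and>
     rmem t ''K'' 0 0 = K \<and> rmem t ''N'' 0 0 = N \<and> (\<forall>i<nS D. \<forall>a<nA D. rmem t ''r'' i a = rew D i a) \<and>
     imem t ''i'' 0 0 < nS D \<and> imem t ''a'' 0 0 < nA D"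

text \<open>Only the preservation of \<open>good_state\<close> depends on an accurate average
  \<open>m\<close>; progress and cost are offered unconditionally, because failed runs must be timed
  too.\<close>

lemma ewp_update:
  fixes s :: state and g :: "state \<Rightarrow> ennreal"
  assumes ld: "loaded K N s" and sum: "rmem s ''sum'' 0 0 / real (imem s ''n'' 0 0) = m"
    and post: "\<And>u. \<lbrakk>loaded K N u; position u = Suc (position s);
        good_state s \<Longrightarrow> mean i a V - 2 * \<eta> * variance i a V - \<beta> \<le> m \<Longrightarrow> m \<le> mean i a V + \<beta> \<Longrightarrow> good_state u;
        steps u \<le> steps s + 160; orc_time u = orc_time s\<rbrakk> \<Longrightarrow> g u \<le> F"
    and ia: "i = imem s ''i'' 0 0" "a = imem s ''a'' 0 0" and V: "V = (\<lambda>j. rmem s ''v'' j 0)"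
  shows "ewp (exec orc (improve ;; advance) s) g \<le> F"
proof -
  let ?k = "imem s ''k'' 0 0"
  have ia': "i < nS D" "a < nA D" using ld ia by (auto simp: loaded_def)
  define q where "q = rew D i a + M + \<gamma> * (m - \<beta>)"
  have q: "q = rmem s ''r'' (imem s ''i'' 0 0) (imem s ''a'' 0 0) + rmem s ''M'' 0 0 +
      rmem s ''gamma'' 0 0 * (rmem s ''sum'' 0 0 / real (imem s ''n'' 0 0) - rmem s ''beta'' 0 0)"
    using ld ia' by (simp add: loaded_def q_def sum ia)
  show ?thesis
    unfolding ewp_exec
  proof (rule ewp_improve[OF q ia(1) V])
    fix t :: state
    assume t: "\<And>z. z \<noteq> ''q'' \<Longrightarrow> z \<noteq> ''v'' \<Longrightarrow> rmem t z = rmem s z" "\<And>z. z \<noteq> ''pi'' \<Longrightarrow> imem t z = imem s z"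
      "(\<lambda>j. rmem t ''v'' j 0) = (if V i < q then V(i := q) else V)"
      "output_policy t = (if V i < q then (output_policy s)(i := imem s ''a'' 0 0) else output_policy s)"
      "steps t \<le> steps s + 80" "orc_time t = orc_time s"
    show "ewp (exec orc advance t) g \<le> F"
    proof (rule ewp_advance[OF refl refl refl refl refl])
      fix u :: state and k' i' a' :: nat
      assume u: "rmem u = rmem t" "\<And>z. z \<noteq> ''k'' \<Longrightarrow> z \<noteq> ''i'' \<Longrightarrow> z \<noteq> ''a'' \<Longrightarrow> imem u z = imem t z"
        "imem u ''k'' 0 0 = k'" "imem u ''i'' 0 0 = i'" "imem u ''a'' 0 0 = a'"
        "(k', i', a') = (if Suc (imem t ''a'' 0 0) < imem t ''A'' 0 0 then (imem t ''k'' 0 0, imem t ''i'' 0 0, Suc (imem t ''a'' 0 0))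
           else if Suc (imem t ''i'' 0 0) < imem t ''S'' 0 0 then (imem t ''k'' 0 0, Suc (imem t ''i'' 0 0), 0)
           else (Suc (imem t ''k'' 0 0), 0, 0))"
        "steps u \<le> steps t + 80" "orc_time u = orc_time t"
      have nxt: "(k', i', a') = (if Suc a < nA D then (?k, i, Suc a) else if Suc i < nS D then (?k, Suc i, 0) else (Suc ?k, 0, 0))"
        using u(6) ld t(2) ia by (simp add: loaded_def)
      have pol: "output_policy u = output_policy t"
        using u(2) by (simp add: output_policy_def fun_eq_iff)
      show "g u \<le> F"
      proof (rule post)
        show "loaded K N u"
          using ld u(1-5) t(1,2) nxt nS_pos nA_pos ia' by (auto simp: loaded_def split: if_splits)
        have end_a: "Suc a = nA D" if "\<not> Suc a < nA D" using that ia' by simp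
        have end_i: "Suc i = nS D" if "\<not> Suc i < nS D" using that ia' by simp
        show "position u = Suc (position s)"
          using nxt u(3-5) end_a end_i unfolding position_def ia[symmetric]
          by (auto split: if_splits) (metis add_Suc_right mult_Suc add.commute)+
        show "steps u \<le> steps s + 160" "orc_time u = orc_time s"
          using u t by auto
        assume good: "good_state s" and m: "mean i a V - 2 * \<eta> * variance i a V - \<beta> \<le> m" "m \<le> mean i a V + \<beta>"
        have "lower_backup \<eta> \<beta> V i a \<le> q" "q \<le> rew D i a + M + \<gamma> * mean i a V"
          using m disc_pos by (auto simp: lower_backup_def q_def)
        then have "good (\<lambda>j. rmem t ''v'' j 0) (output_policy t) ?k i (Suc a)"
          using good ia' unfolding t(3,4) ia(2)[symmetric]
          by (intro good_update[of V "output_policy s" ?k i a q]) (auto simp: good_state_def ia V)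
        then have good_a: "good (\<lambda>j. rmem t ''v'' j 0) (output_policy t) ?k i (Suc a)" .
        then have good_i: "good (\<lambda>j. rmem t ''v'' j 0) (output_policy t) ?k (Suc i) 0" if "Suc a = nA D"
          using that good_next_state by simp
        then have good_k: "good (\<lambda>j. rmem t ''v'' j 0) (output_policy t) (Suc ?k) 0 0"
          if "Suc a = nA D" "Suc i = nS D"
          using that good_next_sweep by simp
        have "good (\<lambda>j. rmem t ''v'' j 0) (output_policy t) k' i' a'"
          using nxt end_a end_i good_a good_i good_k by (auto split: if_splits)
        then show "good_state u" by (simp add: good_state_def u pol)
      qed
    qed
  qed
qed

text \<open>The weights \<open>(c, b) = (1, 0)\<close> give the failure probability and \<open>(0, 1)\<close> the expected time
  spent in the oracle.\<close>

lemma ewp_sweeps: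
  fixes s :: state and N K :: real and L T :: nat and c b :: ennreal
  assumes orc: "sampling_oracle D \<kappa> orc"
    and ld: "loaded K N s" and good: "good_state s" and pos: "position s = 0"
    and T: "T = nat \<lceil>K\<rceil> * nS D * nA D"
    and K: "\<And>k. K \<le> real k \<Longrightarrow> \<gamma> ^ k * (2 * R) \<le> \<epsilon>"
    and N: "0 < N" "real L \<le> \<eta> / 3 * (N * \<beta>)"
    and small: "real T * (2 * exp (- real L)) \<le> 1"
    and post: "\<And>t. steps t \<le> steps s + 300 * (nat \<lceil>N\<rceil> + 1) * T + 20 \<Longrightarrow>
       f t \<le> c * of_bool (\<not> eps_optimal D \<epsilon> (output_policy t)) + b * of_nat (orc_time t)"
  shows "ewp (exec orc sweeps s) f
    \<le> c * ennreal (real T * (2 * exp (- real L))) + b * (of_nat (orc_time s) + ennreal \<kappa> * of_nat (2 * nat \<lceil>N\<rceil> * T))"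
proof -
  define Nn where "Nn = nat \<lceil>N\<rceil>"
  have Nn: "0 < Nn" "N \<le> real Nn" using N(1) by (auto simp: Nn_def)
  define \<rho> where "\<rho> = 2 * exp (- real L)"
  have \<rho>: "0 \<le> \<rho>" by (simp add: \<rho>_def)
  define inv where "inv t \<longleftrightarrow> loaded K N t \<and> position t \<le> T \<and>
     steps t \<le> steps s + 300 * (Nn + 1) * position t" for t
  \<comment> \<open>Union bound over the remaining updates, each failing with probability at most
    \<open>\<rho>\<close>. A bad state is charged 1, which by \<open>risk1\<close> is never less
    than the charge of a good one.\<close>
  define risk where "risk n = ennreal (real (T - n) * \<rho>)" for n
  define I where "I t = (if inv t then c * (if good_state t then risk (position t) else 1) +
     b * (of_nat (orc_time t) + ennreal \<kappa> * of_nat (2 * Nn * (T - position t))) else \<infinity>)" for t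
  have risk1: "risk n \<le> 1" for n
  proof -
    have "real (T - n) * \<rho> \<le> real T * \<rho>" using \<rho> by (intro mult_right_mono) auto
    then have "real (T - n) * \<rho> \<le> 1" using small unfolding \<rho>_def by linarith
    then show ?thesis by (simp add: risk_def)
  qed
  let ?b = "RLess (OfNat (ivar ''k'')) (rvar ''K'')" and ?c = "estimate ;; improve ;; advance"
  have loop: "ewp (exec orc (While ?b ?c) t) f \<le> I t" for t
  proof (rule ewp_While[where m = "\<lambda>t. T - position t"])
    fix t :: state assume b: "bval ?b t"
    show "ewp (exec orc ?c (tick (1 + bcost ?b) t)) (\<lambda>u. if T - position u < T - position t then I u else \<infinity>) \<le> I t"
    proof (cases "inv t")
      case True
      let ?t = "tick (1 + bcost ?b) t"
      define i a where "i = imem t ''i'' 0 0" and "a = imem t ''a'' 0 0"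
      define V where "V = (\<lambda>j. rmem t ''v'' j 0)"
      define n where "n = position t"
      have t: "loaded K N t" "n \<le> T" "steps t \<le> steps s + 300 * (Nn + 1) * n"
        using True by (auto simp: inv_def n_def)
      have ia: "i < nS D" "a < nA D" using t(1) by (auto simp: loaded_def i_def a_def)
      have "imem t ''k'' 0 0 < nat \<lceil>K\<rceil>" using b t(1) by (simp add: loaded_def) linarith
      then have "(imem t ''k'' 0 0 * nS D + i) + 1 \<le> nat \<lceil>K\<rceil> * nS D"
        using ia mult_le_mono1[of "Suc (imem t ''k'' 0 0)" "nat \<lceil>K\<rceil>" "nS D"] by simp
      then have "((imem t ''k'' 0 0 * nS D + i) + 1) * nA D \<le> nat \<lceil>K\<rceil> * nS D * nA D"
        by (rule mult_le_mono1)
      then have nT: "n < T" using ia by (simp add: n_def position_def i_def[symmetric] a_def[symmetric] T)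
      \<comment> \<open>\<open>A1\<close> is the charge if this update does not turn a good state
        bad, \<open>A2\<close> the price of such a failure. In a bad state \<open>A1\<close> already
        contains the full charge 1 and \<open>A2 = 0\<close>, as nothing is known about the range of
        \<open>V\<close>.\<close>
      define A1 A2 where "A1 = c * (if good_state t then risk (Suc n) else 1)
           + b * (ennreal \<kappa> * of_nat (2 * Nn * (T - Suc n)))"
        and "A2 = (if good_state t then c * ennreal (exp (- real L)) else 0)"
      let ?up = "\<lambda>S. exp (\<eta> / 3 * (S - real Nn * mean i a V))"
      let ?dn = "\<lambda>S. exp (\<eta> / 3 * (real Nn * (mean i a V - 2 * \<eta> * variance i a V) - S))"
      \<comment> \<open>Markov's inequality in pointwise form: if the average misses the interval on
        one side, the exponential of that side is at least exp L.\<close>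
      have tail: "1 \<le> exp (- real L) * (?up S + ?dn S)"
        if bad: "\<not> (mean i a V - 2 * \<eta> * variance i a V - \<beta> \<le> S / real Nn \<and> S / real Nn \<le> mean i a V + \<beta>)" for S
      proof -
        have NL: "real L \<le> \<eta> / 3 * (real Nn * \<beta>)"
          using N(2) Nn \<eta>_pos \<beta>_pos by (auto intro: order_trans mult_left_mono mult_right_mono)
        from bad consider "real Nn * \<beta> \<le> S - real Nn * mean i a V"
          | "real Nn * \<beta> \<le> real Nn * (mean i a V - 2 * \<eta> * variance i a V) - S"
          using Nn(1) by (auto simp: field_simps)
        then show ?thesis
        proof cases
          case 1
          then have "real L \<le> \<eta> / 3 * (S - real Nn * mean i a V)"
            using NL \<eta>_pos by (auto intro: order_trans mult_left_mono)
          then have "exp (- real L) * exp (real L) \<le> exp (- real L) * ?up S" by simp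
          also have "\<dots> \<le> exp (- real L) * (?up S + ?dn S)" by (simp add: distrib_left)
          finally show ?thesis by (simp flip: exp_add)
        next
          case 2
          then have "real L \<le> \<eta> / 3 * (real Nn * (mean i a V - 2 * \<eta> * variance i a V) - S)"
            using NL \<eta>_pos by (auto intro: order_trans mult_left_mono)
          then have "exp (- real L) * exp (real L) \<le> exp (- real L) * ?dn S" by simp
          also have "\<dots> \<le> exp (- real L) * (?up S + ?dn S)" by (simp add: distrib_left)
          finally show ?thesis by (simp flip: exp_add)
        qed
      qed
      have "ewp (exec orc ?c ?t) (\<lambda>u. if T - position u < T - position t then I u else \<infinity>)
         = ewp (exec orc estimate ?t) (\<lambda>u. ewp (exec orc (improve ;; advance) u)
             (\<lambda>u. if T - position u < T - position t then I u else \<infinity>))"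
        by simp
      also have "\<dots> \<le> A1 + A2 * 2 + b * (of_nat (orc_time ?t) + ennreal \<kappa> * of_nat (2 * Nn))"
        unfolding Nn_def
      proof (rule ewp_estimate[OF orc, where \<eta> = \<eta> and i = i and a = a and V = V])
        show "imem ?t ''i'' 0 0 = i" "imem ?t ''a'' 0 0 = a" "V = (\<lambda>j. rmem ?t ''v'' j 0)"
          by (simp_all add: i_def a_def V_def)
        show "i < nS D" "a < nA D" by (fact ia)+
        show "rmem ?t ''eta'' 0 0 = \<eta>" "rmem ?t ''N'' 0 0 = N" using t(1) by (simp_all add: loaded_def)
        show "0 \<le> \<eta>" "\<eta> * R \<le> 1" using \<eta>_pos \<eta>_R_le R_pos by auto
        show "A2 = 0 \<or> (\<forall>j<nS D. 0 \<le> V j \<and> V j \<le> R)"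
          unfolding A2_def good_state_def good_def V_def by auto
        fix u :: state
        assume u: "agree ?t u" "imem u ''n'' 0 0 = nat \<lceil>N\<rceil>" "steps u \<le> steps ?t + 100 * (nat \<lceil>N\<rceil> + 1)"
        let ?S = "rmem u ''sum'' 0 0"
        have u_eq: "imem u z = imem t z" if "z \<notin> {''n'', ''x'', ''y''}" for z
          using u(1) that by (simp add: agree_def)
        have u_eq': "rmem u z = rmem t z" if "z \<noteq> ''sum''" for z
          using u(1) that by (simp add: agree_def)
        have ld_u: "loaded K N u" using t(1) by (simp add: loaded_def u_eq u_eq')
        have pos_u: "position u = n" by (simp add: position_def n_def u_eq)
        have "output_policy u = output_policy t" by (simp add: output_policy_def fun_eq_iff u_eq)
        then have good_u: "good_state u \<longleftrightarrow> good_state t" by (simp add: good_state_def u_eq u_eq')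
        show "ewp (exec orc (improve ;; advance) u) (\<lambda>u. if T - position u < T - position t then I u else \<infinity>)
           \<le> A1 + A2 * ennreal (exp (\<eta> / 3 * (?S - real (nat \<lceil>N\<rceil>) * mean i a V))
              + exp (\<eta> / 3 * (real (nat \<lceil>N\<rceil>) * (mean i a V - 2 * \<eta> * variance i a V) - ?S)))
              + b * of_nat (orc_time u)"
          unfolding Nn_def[symmetric]
        proof (rule ewp_update[OF ld_u, where m = "?S / real Nn" and i = i and a = a and V = V])
          show "rmem u ''sum'' 0 0 / real (imem u ''n'' 0 0) = ?S / real Nn" by (simp add: u Nn_def)
          show "i = imem u ''i'' 0 0" "a = imem u ''a'' 0 0" "V = (\<lambda>j. rmem u ''v'' j 0)"
            by (simp_all add: i_def a_def V_def u_eq u_eq')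
          fix w :: state
          assume w: "loaded K N w" "position w = Suc (position u)"
            "good_state u \<Longrightarrow> mean i a V - 2 * \<eta> * variance i a V - \<beta> \<le> ?S / real Nn \<Longrightarrow>
               ?S / real Nn \<le> mean i a V + \<beta> \<Longrightarrow> good_state w"
            "steps w \<le> steps u + 160" "orc_time w = orc_time u"
          \<comment> \<open>The 9 is the cost of the loop guard; 9 + 160 is covered by the remaining
            200 (Nn + 1).\<close>
          have "steps w \<le> steps s + 300 * (Nn + 1) * n + (9 + 100 * (Nn + 1) + 160)"
            using w(4) u(3) t(3) by (simp add: Nn_def)
          also have "\<dots> \<le> steps s + 300 * (Nn + 1) * Suc n" by (simp add: algebra_simps)
          finally have "inv w" using w(1,2) nT by (simp add: inv_def pos_u)
          have main: "c * (if good_state w then risk (Suc n) else 1)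
            \<le> c * (if good_state t then risk (Suc n) else 1) + A2 * ennreal (?up ?S + ?dn ?S)"
          proof (cases "good_state t \<and> \<not> good_state w")
            case True
            then have "\<not> (mean i a V - 2 * \<eta> * variance i a V - \<beta> \<le> ?S / real Nn \<and> ?S / real Nn \<le> mean i a V + \<beta>)"
              using w(3) good_u by blast
            then have "1 \<le> ennreal (exp (- real L) * (?up ?S + ?dn ?S))"
              using ennreal_leI[OF tail] by simp
            also have "\<dots> = ennreal (exp (- real L)) * ennreal (?up ?S + ?dn ?S)"
              by (intro ennreal_mult add_nonneg_nonneg) simp_all
            finally have "c * 1 \<le> c * (ennreal (exp (- real L)) * ennreal (?up ?S + ?dn ?S))"
              by (intro mult_left_mono) auto
            then show ?thesis using True by (simp add: A2_def mult.assoc add_increasing)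
          next
            case False
            then have "c * (if good_state w then risk (Suc n) else 1) \<le> c * (if good_state t then risk (Suc n) else 1)"
              using risk1 by (intro mult_left_mono) auto
            then show ?thesis by (simp add: add_increasing2)
          qed
          have "T - position w < T - position t" using w(2) pos_u nT n_def by simp
          then have "(if T - position w < T - position t then I w else \<infinity>)
              = c * (if good_state w then risk (Suc n) else 1)
                + b * (of_nat (orc_time u) + ennreal \<kappa> * of_nat (2 * Nn * (T - Suc n)))"
            using \<open>inv w\<close> w(2,5) by (simp add: I_def pos_u del: of_nat_mult)
          also have "\<dots> \<le> c * (if good_state t then risk (Suc n) else 1) + A2 * ennreal (?up ?S + ?dn ?S)
                + b * (of_nat (orc_time u) + ennreal \<kappa> * of_nat (2 * Nn * (T - Suc n)))"
            by (intro add_right_mono main)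
          also have "\<dots> = A1 + A2 * ennreal (?up ?S + ?dn ?S) + b * of_nat (orc_time u)"
            by (simp only: A1_def distrib_left add_ac)
          finally show "(if T - position w < T - position t then I w else \<infinity>)
             \<le> A1 + A2 * ennreal (?up ?S + ?dn ?S) + b * of_nat (orc_time u)" .
        qed
      qed
      also have "\<dots> = I t"
      proof -
        have Tn: "T - n = Suc (T - Suc n)" using nT by simp
        have r: "risk n = risk (Suc n) + ennreal (exp (- real L)) * 2"
          unfolding risk_def Tn using \<rho>
          by (simp add: \<rho>_def algebra_simps ennreal_plus ennreal_mult flip: ennreal_numeral)
        have "2 * Nn * (T - n) = 2 * Nn * (T - Suc n) + 2 * Nn" unfolding Tn by simp
        then have o: "(of_nat (2 * Nn * (T - n)) :: ennreal) = of_nat (2 * Nn * (T - Suc n)) + of_nat (2 * Nn)"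
          by (metis of_nat_add)
        have "I t = c * (if good_state t then risk n else 1) + b * (of_nat (orc_time t) + ennreal \<kappa> * of_nat (2 * Nn * (T - n)))"
          using True by (simp add: I_def n_def)
        also have "c * (if good_state t then risk n else 1) = c * (if good_state t then risk (Suc n) else 1) + A2 * 2"
          by (simp add: A2_def r distrib_left mult.assoc)
        finally show ?thesis unfolding o A1_def by (simp only: distrib_left add_ac memory_simps)
      qed
      finally show ?thesis .
    qed (simp add: I_def)
  next
    fix t :: state assume b: "\<not> bval ?b t"
    show "f (tick (1 + bcost ?b) t) \<le> I t"
    proof (cases "inv t")
      case True
      let ?t = "tick (1 + bcost ?b) t"
      have pol: "output_policy ?t = output_policy t" by (simp add: output_policy_def fun_eq_iff)
      have "steps t \<le> steps s + 300 * (Nn + 1) * T"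
        using True by (auto simp: inv_def intro: order_trans mult_le_mono2)
      then have "f ?t \<le> c * of_bool (\<not> eps_optimal D \<epsilon> (output_policy t)) + b * of_nat (orc_time t)"
        using post[of ?t] pol by (simp add: Nn_def)
      also have "\<dots> \<le> I t"
      proof -
        have "K \<le> real (imem t ''k'' 0 0)" using b True by (simp add: inv_def loaded_def)
        then have "eps_optimal D \<epsilon> (output_policy t)" if "good_state t"
          using that K good_eps_optimal unfolding good_state_def by blast
        then have "c * of_bool (\<not> eps_optimal D \<epsilon> (output_policy t)) \<le> c * (if good_state t then risk (position t) else 1)"
          by (intro mult_left_mono) auto
        moreover have "b * of_nat (orc_time t)
            \<le> b * (of_nat (orc_time t) + ennreal \<kappa> * of_nat (2 * Nn * (T - position t)))"
          by (intro mult_left_mono) auto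
        ultimately have "c * of_bool (\<not> eps_optimal D \<epsilon> (output_policy t)) + b * of_nat (orc_time t)
            \<le> c * (if good_state t then risk (position t) else 1)
              + b * (of_nat (orc_time t) + ennreal \<kappa> * of_nat (2 * Nn * (T - position t)))"
          by (rule add_mono)
        then show ?thesis unfolding I_def if_P[OF True] .
      qed
      finally show ?thesis .
    qed (simp add: I_def)
  qed
  have "I s = c * ennreal (real T * \<rho>) + b * (of_nat (orc_time s) + ennreal \<kappa> * of_nat (2 * Nn * T))"
    using ld good pos by (simp add: I_def inv_def risk_def)
  then show ?thesis
    using loop[of s] by (simp add: sweeps_def \<rho>_def Nn_def)
qed

end

section \<open>Parameters and running time\<close>

text \<open>\<open>ewp\<close> charges \<open>None\<close> with infinity, so nontermination counts
  as failure and the rest of the mass lies on states satisfying \<open>Q\<close>.\<close>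

lemma measure_ge_of_ewp:
  assumes "ewp p (\<lambda>t. of_bool (\<not> Q t)) \<le> ennreal d" "0 \<le> d"
  shows "1 - d \<le> measure (measure_spmf p) {t. Q t}"
proof -
  let ?A = "Some ` {t. Q t}"
  have "emeasure (measure_pmf p) (UNIV - ?A) = (\<integral>\<^sup>+ x. indicator (UNIV - ?A) x \<partial>measure_pmf p)"
    by simp
  also have "\<dots> \<le> ewp p (\<lambda>t. of_bool (\<not> Q t))"
    unfolding ewp_def by (intro nn_integral_mono) (auto split: option.split simp: indicator_def)
  finally have "ennreal (measure (measure_pmf p) (UNIV - ?A)) \<le> ewp p (\<lambda>t. of_bool (\<not> Q t))"
    by (simp add: measure_pmf.emeasure_eq_measure)
  from order_trans[OF this assms(1)] have "measure (measure_pmf p) (UNIV - ?A) \<le> d"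
    using assms(2) by simp
  moreover have "measure (measure_pmf p) (UNIV - ?A) = 1 - measure (measure_pmf p) ?A"
    using measure_pmf.prob_compl[of ?A p] by simp
  ultimately show ?thesis
    by (simp add: measure_measure_spmf_conv_measure_pmf)
qed

lemma ewp_const_add: "ewp p (\<lambda>t. c + f t) \<le> c + ewp p f"
proof -
  have "ewp p (\<lambda>t. c + f t) \<le> (\<integral>\<^sup>+ x. c + (case x of None \<Rightarrow> \<infinity> | Some s \<Rightarrow> f s) \<partial>measure_pmf p)"
    unfolding ewp_def by (intro nn_integral_mono) (auto split: option.split)
  then show ?thesis by (simp add: ewp_def nn_integral_add measure_pmf.emeasure_space_1)
qed

lemma half_le_ln_2: "1 / 2 \<le> ln (2 :: real)"
  using ln_add_one_self_le_self2[of "-1/2"] by (simp add: ln_div)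

lemma two_power_le_exp: "2 ^ n \<le> exp (real n)"
proof -
  have "(2::real) ^ n \<le> exp 1 ^ n"
    using exp_ge_add_one_self[of 1] by (intro power_mono) auto
  then show ?thesis by (simp add: exp_of_nat_mult[symmetric])
qed

text \<open>The factor 2 is 1 / ln 2 rounded up. Minimality of a doubling exponent thus becomes a
  logarithm of the inputs.\<close>

lemma exponent_le:
  fixes Y :: real
  assumes "2 ^ n < Y ^ m * z" "0 < Y" "0 < z"
  shows "real n \<le> 2 * (real m * ln Y + ln z)"
proof -
  have "ln (2 ^ n) \<le> ln (Y ^ m * z)" using assms by (intro ln_mono) auto
  also have "\<dots> = real m * ln Y + ln z" using assms by (simp add: ln_mult ln_realpow)
  finally have "real n * ln 2 \<le> real m * ln Y + ln z" by (simp add: ln_realpow)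
  moreover have "real n * (1 / 2) \<le> real n * ln 2" using half_le_ln_2 by (intro mult_left_mono) auto
  ultimately show ?thesis by simp
qed

lemma ewp_set_horizon:
  fixes s :: state and f :: "state \<Rightarrow> ennreal"
  assumes "\<And>t. \<lbrakk>imem t = imem s; \<And>z. z \<notin> {''H'', ''R'', ''X''} \<Longrightarrow> rmem t z = rmem s z;
      rmem t ''H'' 0 0 = 1 / (1 - rmem s ''gamma'' 0 0);
      rmem t ''R'' 0 0 = 2 * (1 / (1 - rmem s ''gamma'' 0 0)) * rmem s ''M'' 0 0;
      rmem t ''X'' 0 0 = 2 * (2 * (1 / (1 - rmem s ''gamma'' 0 0)) * rmem s ''M'' 0 0) / rmem s ''eps'' 0 0;
      orc_time t = orc_time s; steps t \<le> steps s + 60\<rbrakk> \<Longrightarrow> f t \<le> F"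
  shows "ewp (exec orc set_horizon s) f \<le> F"
  unfolding set_horizon_def ewp_exec by (rule assms) simp_all

lemma ewp_set_sweeps:
  fixes s :: state and f :: "state \<Rightarrow> ennreal"
  assumes "\<And>t. \<lbrakk>imem t = imem s; \<And>z. z \<notin> {''K'', ''X''} \<Longrightarrow> rmem t z = rmem s z;
      rmem t ''K'' 0 0 = rmem s ''H'' 0 0 * rmem s ''l'' 0 0;
      rmem t ''X'' 0 0 = 2 * (real (imem s ''S'' 0 0) * real (imem s ''A'' 0 0))
        * (rmem s ''H'' 0 0 * rmem s ''l'' 0 0 + 1) / rmem s ''delta'' 0 0;
      orc_time t = orc_time s; steps t \<le> steps s + 60\<rbrakk> \<Longrightarrow> f t \<le> F"
  shows "ewp (exec orc set_sweeps s) f \<le> F"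
  unfolding set_sweeps_def ewp_exec by (rule assms) simp_all

lemma ewp_set_precision:
  fixes s :: state and f :: "state \<Rightarrow> ennreal"
  assumes "\<And>t. \<lbrakk>imem t = imem s; \<And>z. z \<notin> {''N'', ''eta'', ''beta''} \<Longrightarrow> rmem t z = rmem s z;
      rmem t ''N'' 0 0 = 1536 * rmem s ''l'' 0 0 * (rmem s ''R'' 0 0 * rmem s ''R'' 0 0) * rmem s ''H'' 0 0
        / (rmem s ''eps'' 0 0 * rmem s ''eps'' 0 0);
      rmem t ''eta'' 0 0 = rmem s ''eps'' 0 0 / (32 * (rmem s ''R'' 0 0 * rmem s ''R'' 0 0));
      rmem t ''beta'' 0 0 = rmem s ''eps'' 0 0 / (16 * rmem s ''H'' 0 0);
      orc_time t = orc_time s; steps t \<le> steps s + 80\<rbrakk> \<Longrightarrow> f t \<le> F"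
  shows "ewp (exec orc set_precision s) f \<le> F"
  unfolding set_precision_def ewp_exec by (rule assms) simp_all

context sampled_value_iteration
begin

lemma ewp_parameters:
  assumes ia: "s = tick c (init_state D M \<epsilon> \<delta>)"
    and post: "\<And>t l L K N. \<lbrakk>K = H * real l; N = 1536 * real L * (R * R) * H / (\<epsilon> * \<epsilon>);
        2 * R / \<epsilon> \<le> 2 ^ l; l = 0 \<or> 2 ^ l < 2 * (2 * R / \<epsilon>);
        2 * (real (nS D) * real (nA D)) * (K + 1) / \<delta> \<le> 2 ^ L;
        L = 0 \<or> 2 ^ L < 2 * (2 * (real (nS D) * real (nA D)) * (K + 1) / \<delta>);
        loaded K N t; good_state t; position t = 0; orc_time t = 0;
        steps t \<le> c + 50 * l + 50 * L + 300\<rbrakk> \<Longrightarrow> f t \<le> F"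
  shows "ewp (exec orc parameters s) f \<le> F"
proof -
  have s: "imem s = (\<lambda>x i j. if i = 0 \<and> j = 0 \<and> x = ''S'' then nS D
               else if i = 0 \<and> j = 0 \<and> x = ''A'' then nA D else 0)"
    "rmem s ''M'' 0 0 = M" "rmem s ''gamma'' 0 0 = \<gamma>" "rmem s ''eps'' 0 0 = \<epsilon>" "rmem s ''delta'' 0 0 = \<delta>"
    "\<And>i a. i < nS D \<Longrightarrow> a < nA D \<Longrightarrow> rmem s ''r'' i a = rew D i a" "rmem s ''v'' = (\<lambda>i j. 0)"
    "orc_time s = 0" "steps s = c"
    by (simp_all add: ia init_state_def)
  show ?thesis
    unfolding parameters_def ewp_exec
  proof (rule ewp_set_horizon, rule ewp_doubling, rule ewp_set_sweeps, rule ewp_doubling, rule ewp_set_precision,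
      goal_cases)
    case (1 t\<^sub>1 t\<^sub>2 l t\<^sub>3 t\<^sub>4 L t)
    have H: "rmem t\<^sub>1 ''H'' 0 0 = H" and R: "rmem t\<^sub>1 ''R'' 0 0 = R" and X\<^sub>1: "rmem t\<^sub>1 ''X'' 0 0 = 2 * R / \<epsilon>"
      using 1(3-5) by (simp_all add: s H_def R_def)
    have frame: "rmem t z = rmem s z"
      if "z \<notin> {''H'', ''R'', ''X'', ''p'', ''l'', ''K'', ''N'', ''eta'', ''beta''}" for z
      using 1(2,9,16,22,29) that by simp
    have imem: "imem t = imem s" using 1(1,8,15,21,28) by simp
    have K: "rmem t\<^sub>3 ''K'' 0 0 = H * real l"
      using 1(9,10,17) H by simp
    have X\<^sub>3: "rmem t\<^sub>3 ''X'' 0 0 = 2 * (real (nS D) * real (nA D)) * (H * real l + 1) / \<delta>"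
      using 1(1,2,8,9,10,18) s H by simp
    have eps: "rmem t\<^sub>4 ''eps'' 0 0 = \<epsilon>" and H\<^sub>4: "rmem t\<^sub>4 ''H'' 0 0 = H" and R\<^sub>4: "rmem t\<^sub>4 ''R'' 0 0 = R"
      using 1(2,9,16,22) s H R by simp_all
    show ?case
    proof (rule post[OF refl refl])
      show "2 * R / \<epsilon> \<le> 2 ^ l" "l = 0 \<or> 2 ^ l < 2 * (2 * R / \<epsilon>)"
        using 1(11,12) by (simp_all add: X\<^sub>1)
      show "2 * (real (nS D) * real (nA D)) * (H * real l + 1) / \<delta> \<le> 2 ^ L"
        "L = 0 \<or> 2 ^ L < 2 * (2 * (real (nS D) * real (nA D)) * (H * real l + 1) / \<delta>)"
        using 1(24,25) by (simp_all add: X\<^sub>3)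
      have "rmem t ''K'' 0 0 = H * real l" using 1(22,29) K by simp
      moreover have "rmem t ''N'' 0 0 = 1536 * real L * (R * R) * H / (\<epsilon> * \<epsilon>)"
        "rmem t ''eta'' 0 0 = \<eta>" "rmem t ''beta'' 0 0 = \<beta>"
        using 1(23,30-32) by (simp_all add: eps H\<^sub>4 R\<^sub>4 \<eta>_def \<beta>_def)
      ultimately show "loaded (H * real l) (1536 * real L * (R * R) * H / (\<epsilon> * \<epsilon>)) t"
        using nS_pos nA_pos by (simp add: loaded_def imem frame s)
      have "output_policy t = (\<lambda>_. 0)" by (simp add: output_policy_def fun_eq_iff imem s)
      then show "good_state t" using good_init by (simp add: good_state_def imem frame s)
      show "position t = 0" by (simp add: position_def imem s)
      show "orc_time t = 0" using 1(6,13,19,26,33) s by simp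
      show "steps t \<le> c + 50 * l + 50 * L + 300" using 1(7,14,20,27,34) s by simp
    qed
  qed
qed

text \<open>From \<gamma> <= exp (-(1 - \<gamma>)), H l sweeps contract by exp (-l), which is at
  most 2^(-l) because e >= 2.\<close>

lemma discount_power_le:
  assumes "2 * R / \<epsilon> \<le> 2 ^ l" "H * real l \<le> real k"
  shows "\<gamma> ^ k * (2 * R) \<le> \<epsilon>"
proof -
  have "real l = (1 - \<gamma>) * (H * real l)" using H_eq by (simp flip: mult.assoc)
  also have "\<dots> \<le> (1 - \<gamma>) * real k" using assms(2) disc_less by (intro mult_left_mono) auto
  finally have l: "real l \<le> (1 - \<gamma>) * real k" .
  have "\<gamma> \<le> exp (- (1 - \<gamma>))" using exp_ge_add_one_self[of "- (1 - \<gamma>)"] by simp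
  then have "\<gamma> ^ k \<le> exp (- (1 - \<gamma>)) ^ k" using disc_pos by (intro power_mono) auto
  also have "\<dots> = exp (- ((1 - \<gamma>) * real k))" by (simp add: exp_of_nat_mult[symmetric] algebra_simps)
  also have "\<dots> \<le> exp (- real l)" using l by simp
  finally have "\<gamma> ^ k * (2 * R) \<le> exp (- real l) * (2 * R)" using R_pos by (intro mult_right_mono) auto
  also have "2 * R \<le> 2 ^ l * \<epsilon>" using assms(1) eps_pos by (simp add: field_simps)
  also have "2 ^ l * \<epsilon> \<le> exp (real l) * \<epsilon>" using two_power_le_exp eps_pos by (intro mult_right_mono) auto
  finally show ?thesis by (simp flip: exp_add mult.assoc)
qed

lemma ewp_solver:
  fixes c b :: ennreal
  assumes orc: "sampling_oracle D \<kappa> orc" and \<delta>: "0 < \<delta>" "\<delta> < 1"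
    and post: "\<And>t l L N T. \<lbrakk>N = 1536 * real L * (R * R) * H / (\<epsilon> * \<epsilon>); T = nat \<lceil>H * real l\<rceil> * nS D * nA D;
        1 \<le> l; 1 \<le> L; 2 ^ l < 4 * R / \<epsilon>;
        2 ^ L < 4 * (real (nS D) * real (nA D)) * (H * real l + 1) / \<delta>\<rbrakk>
        \<Longrightarrow> 300 + 50 * l + 50 * L + 300 * (nat \<lceil>N\<rceil> + 1) * T + 50 \<le> B"
    and f: "\<And>t. steps t \<le> B \<Longrightarrow> f t \<le> c * of_bool (\<not> eps_optimal D \<epsilon> (output_policy t)) + b * of_nat (orc_time t)"
  shows "ewp (exec orc solver (init_state D M \<epsilon> \<delta>)) f \<le> c * ennreal \<delta> + b * (ennreal \<kappa> * of_nat B)"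
proof -
  have cond: "bval (RLess (rvar ''eps'')
       (RMul (RMul (rlit 2) (RDiv (rlit 1) (RSub (rlit 1) (rvar ''gamma'')))) (rvar ''M''))) (init_state D M \<epsilon> \<delta>)"
    using eps_less by (simp add: init_state_def R_def H_def)
  show ?thesis
    unfolding solver_def ewp_exec if_P[OF cond]
  proof (rule ewp_parameters[OF refl])
    fix t l L K N
    assume K: "K = H * real l" and N: "N = 1536 * real L * (R * R) * H / (\<epsilon> * \<epsilon>)"
      and l: "2 * R / \<epsilon> \<le> 2 ^ l" "l = 0 \<or> 2 ^ l < 2 * (2 * R / \<epsilon>)"
      and L: "2 * (real (nS D) * real (nA D)) * (K + 1) / \<delta> \<le> 2 ^ L"
        "L = 0 \<or> 2 ^ L < 2 * (2 * (real (nS D) * real (nA D)) * (K + 1) / \<delta>)"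
      and t: "loaded K N t" "good_state t" "position t = 0" "orc_time t = 0"
        "steps t \<le> 1 + bcost (RLess (rvar ''eps'')
       (RMul (RMul (rlit 2) (RDiv (rlit 1) (RSub (rlit 1) (rvar ''gamma'')))) (rvar ''M'')))
           + 50 * l + 50 * L + 300"
    define T where "T = nat \<lceil>H * real l\<rceil> * nS D * nA D"
    have SA: "1 \<le> real (nS D) * real (nA D)"
      using nS_pos nA_pos mult_mono[of 1 "real (nS D)" 1 "real (nA D)"] by simp
    have "1 < 2 * R / \<epsilon>" using eps_less eps_pos by (simp add: field_simps)
    then have l1: "1 \<le> l" using l(1) by (cases l) auto
    have K0: "0 \<le> K" using H_pos by (simp add: K)
    have X2: "2 \<le> 2 * (real (nS D) * real (nA D)) * (K + 1)"
      using mult_mono[OF SA, of 1 "K + 1"] K0 by (simp add: mult.assoc)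
    then have "2 < 2 * (real (nS D) * real (nA D)) * (K + 1) / \<delta>"
      using \<delta> by (simp add: field_simps)
    then have L1: "1 \<le> L" using L(1) by (cases L) auto
    have T_le: "real T \<le> (K + 1) * (real (nS D) * real (nA D))"
    proof -
      have "real (nat \<lceil>K\<rceil>) \<le> K + 1" using K0 by linarith
      then show ?thesis
        unfolding T_def K[symmetric] using SA by (simp add: mult_right_mono mult.assoc)
    qed
    \<comment> \<open>The second \<open>X\<close> is twice the bound \<open>T_le\<close> on the
      number of updates, divided by \<delta>, and X <= 2^L <= exp L.\<close>
    have fail: "real T * (2 * exp (- real L)) \<le> \<delta>"
    proof -
      have "2 * (real (nS D) * real (nA D)) * (K + 1) \<le> \<delta> * 2 ^ L"
        using L(1) \<delta> by (simp add: field_simps)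
      also have "\<dots> \<le> \<delta> * exp (real L)" using two_power_le_exp \<delta> by (intro mult_left_mono) auto
      finally have "2 * real T \<le> \<delta> * exp (real L)" using T_le by (simp add: mult_ac)
      then have "2 * real T * exp (- real L) \<le> \<delta> * exp (real L) * exp (- real L)"
        by (intro mult_right_mono) auto
      then show ?thesis by (simp add: mult_ac flip: exp_add)
    qed
    have B: "300 + 50 * l + 50 * L + 300 * (nat \<lceil>N\<rceil> + 1) * T + 50 \<le> B"
      using post[OF N T_def l1 L1] l(2) L(2) l1 L1 K by (simp add: mult.assoc)
    have "ewp (exec orc sweeps t) f
      \<le> c * ennreal (real T * (2 * exp (- real L))) + b * (of_nat (orc_time t) + ennreal \<kappa> * of_nat (2 * nat \<lceil>N\<rceil> * T))"
    proof (rule ewp_sweeps[OF orc t(1-3)])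
      show "T = nat \<lceil>K\<rceil> * nS D * nA D" by (simp add: T_def K)
      show "\<gamma> ^ k * (2 * R) \<le> \<epsilon>" if "K \<le> real k" for k
        using discount_power_le[OF l(1)] that K by simp
      show "0 < N" using L1 R_pos H_pos eps_pos by (simp add: N)
      show "real L \<le> \<eta> / 3 * (N * \<beta>)"
        using R_pos H_pos eps_pos by (simp add: N \<eta>_def \<beta>_def)
      show "real T * (2 * exp (- real L)) \<le> 1" using fail \<delta> by simp
      fix u :: state assume "steps u \<le> steps t + 300 * (nat \<lceil>N\<rceil> + 1) * T + 20"
      then have "steps u \<le> B" using B t(5) by simp
      then show "f u \<le> c * of_bool (\<not> eps_optimal D \<epsilon> (output_policy u)) + b * of_nat (orc_time u)"
        by (rule f)
    qed
    also have "\<dots> \<le> c * ennreal \<delta> + b * (ennreal \<kappa> * of_nat B)"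
    proof (intro add_mono mult_left_mono ennreal_leI fail)
      \<comment> \<open>The number of oracle calls, two per pair, also fits into \<open>B\<close>,
        so one number bounds steps and, times \<kappa>, oracle time.\<close>
      have "2 * nat \<lceil>N\<rceil> * T \<le> B"
        using B by (intro order_trans[OF _ B]) (simp add: algebra_simps)
      then have "(of_nat (2 * nat \<lceil>N\<rceil> * T) :: ennreal) \<le> of_nat B" by (rule of_nat_mono)
      then show "of_nat (orc_time t) + ennreal \<kappa> * of_nat (2 * nat \<lceil>N\<rceil> * T) \<le> ennreal \<kappa> * of_nat B"
        using t(4) by (simp add: mult_left_mono del: of_nat_mult)
    qed auto
    finally show "ewp (exec orc sweeps t) f \<le> c * ennreal \<delta> + b * (ennreal \<kappa> * of_nat B)" .
  qed
qed

lemma solver_time: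
  assumes \<delta>: "0 < \<delta>" "\<delta> < 1" and N: "N = 1536 * real L * (R * R) * H / (\<epsilon> * \<epsilon>)"
    and T: "T = nat \<lceil>H * real l\<rceil> * nS D * nA D" and l: "1 \<le> l" "2 ^ l < 4 * R / \<epsilon>"
    and L: "1 \<le> L" "2 ^ L < 4 * (real (nS D) * real (nA D)) * (H * real l + 1) / \<delta>"
  shows "real (300 + 50 * l + 50 * L + 300 * (nat \<lceil>N\<rceil> + 1) * T + 50)
    \<le> 4718592000 * main_bound D M \<epsilon> \<delta> * log_input D M \<epsilon> ^ 2"
proof -
  define S A where "S = real (nS D)" and "A = real (nA D)"
  define Y where "Y = 2 + S + A + M + H + 1 / \<epsilon>"
  define \<omega> where "\<omega> = max 1 (ln (1 / \<delta>))"
  have S: "1 \<le> S" "1 \<le> A" using nS_pos nA_pos by (auto simp: S_def A_def)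
  then have SA: "1 \<le> S * A" using mult_mono[of 1 S 1 A] by simp
  have eps: "0 < 1 / \<epsilon>" using eps_pos by simp
  have Y: "5 \<le> Y" "S \<le> Y" "A \<le> Y" "M \<le> Y" "H \<le> Y" "1 / \<epsilon> \<le> Y"
    using S M_pos H_ge_1 eps unfolding Y_def by linarith+
  have log: "log_input D M \<epsilon> = ln Y"
    by (simp add: log_input_def Y_def S_def A_def H_def)
  have lnY: "1 \<le> ln Y"
  proof -
    have "exp 1 \<le> Y" using exp_le Y(1) by simp
    then show ?thesis using Y(1) by (simp add: ln_ge_iff)
  qed
  \<comment> \<open>8 H M / \<epsilon> has three factors at most \<open>Y\<close>, and 8 <= Y^2
    since Y >= 5; the exponent 5 is doubled by \<open>exponent_le\<close>.\<close>
  have l_le: "real l \<le> 10 * ln Y"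
  proof -
    have "4 * R / \<epsilon> = 8 * (H * M * (1 / \<epsilon>))" by (simp add: R_def)
    also have "\<dots> \<le> (Y * Y) * (Y * Y * Y)"
    proof (intro mult_mono)
      show "8 \<le> Y * Y" using mult_mono[of 5 Y 5 Y] Y(1) by simp
    qed (use Y H_pos M_pos eps in \<open>auto intro!: mult_nonneg_nonneg\<close>)
    also have "\<dots> = Y ^ 5 * 1" by (simp add: power_numeral_reduce)
    finally show ?thesis using exponent_le[of l Y 5 1] l Y by simp
  qed
  \<comment> \<open>Two powers of \<open>Y\<close> for |S||A|, two for the number of sweeps and
    three to absorb the 44 make 7; together with ln (1/\<delta>) and the doubling this gives
    16.\<close>
  have L_le: "real L \<le> 16 * ln Y * \<omega>"
  proof -
    have "ln Y \<le> Y" using Y(1) ln_le_minus_one[of Y] by simp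
    then have "H * real l \<le> Y * (10 * Y)"
      using l_le Y H_pos by (intro mult_mono) auto
    moreover have "1 \<le> Y * Y" using mult_mono[of 1 Y 1 Y] Y(1) by simp
    ultimately have K: "H * real l + 1 \<le> 11 * (Y * Y)" by simp
    have "4 * (S * A) * (H * real l + 1) \<le> 4 * (Y * Y) * (11 * (Y * Y))"
      using K Y S H_pos by (intro mult_mono) auto
    also have "\<dots> = 44 * Y ^ 4" by (simp add: power_numeral_reduce)
    also have "\<dots> \<le> Y ^ 3 * Y ^ 4"
      using power_mono[of 5 Y 3] Y(1) by (intro mult_right_mono) auto
    also have "\<dots> = Y ^ 7" by (simp flip: power_add)
    finally have "4 * (S * A) * (H * real l + 1) / \<delta> \<le> Y ^ 7 * (1 / \<delta>)"
      using \<delta> by (simp add: divide_right_mono)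
    then have "real L \<le> 2 * (7 * ln Y + ln (1 / \<delta>))"
      using exponent_le[of L Y 7 "1 / \<delta>"] L(2) Y \<delta> by (simp add: S_def A_def)
    also have "\<dots> \<le> 2 * (7 * (ln Y * \<omega>) + ln Y * \<omega>)"
    proof -
      have "1 \<le> \<omega>" "ln (1 / \<delta>) \<le> \<omega>" by (auto simp: \<omega>_def)
      then have "ln Y * 1 \<le> ln Y * \<omega>" "1 * \<omega> \<le> ln Y * \<omega>" "ln (1 / \<delta>) \<le> \<omega>"
        using lnY by (auto intro: mult_left_mono mult_right_mono)
      then have "ln Y \<le> ln Y * \<omega>" "ln (1 / \<delta>) \<le> ln Y * \<omega>" by simp_all
      then show ?thesis by (intro mult_left_mono add_mono) auto
    qed
    finally show ?thesis by (simp add: mult_ac)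
  qed
  define m where "m = S * A * H ^ 4 * M\<^sup>2 / \<epsilon>\<^sup>2"
  have main: "main_bound D M \<epsilon> \<delta> = S + m * \<omega>"
    by (simp add: main_bound_def m_def \<omega>_def S_def A_def H_def power_divide)
  have R\<epsilon>: "1 \<le> (R * R) / (\<epsilon> * \<epsilon>)"
    using mult_mono[of \<epsilon> R \<epsilon> R] eps_less eps_pos by simp
  have HL: "1 \<le> H * real l" "real l \<le> H * real l"
    using H_ge_1 l(1) mult_mono[of 1 H 1 "real l"] mult_right_mono[of 1 H "real l"] by auto
  have NL: "1 \<le> N" "real L \<le> N"
  proof -
    have "real L * 1 \<le> (1536 * real L) * ((R * R) / (\<epsilon> * \<epsilon>) * H)"
      using mult_mono[OF R\<epsilon> H_ge_1] L(1) by (intro mult_mono) auto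
    then show "real L \<le> N" by (simp add: N)
    then show "1 \<le> N" using L(1) by simp
  qed
  have T1: "1 \<le> real T" "real l \<le> real T" "real T \<le> 2 * (H * real l) * (S * A)"
  proof -
    have Kn: "H * real l \<le> real (nat \<lceil>H * real l\<rceil>)" "real (nat \<lceil>H * real l\<rceil>) \<le> 2 * (H * real l)"
      using HL by linarith+
    have Te: "real T = real (nat \<lceil>H * real l\<rceil>) * (S * A)" by (simp add: T S_def A_def)
    have "H * real l * 1 \<le> real T" unfolding Te using Kn SA HL by (intro mult_mono) auto
    then show "1 \<le> real T" "real l \<le> real T" using HL by linarith+
    show "real T \<le> 2 * (H * real l) * (S * A)" unfolding Te using Kn SA by (intro mult_right_mono) auto
  qed
  define n where "n = real (nat \<lceil>N\<rceil>) + 1"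
  have n: "2 \<le> n" "real L \<le> n" "n \<le> 3 * N" using NL unfolding n_def by linarith+
  have nT: "real L \<le> n * real T" "real l \<le> n * real T" "2 \<le> n * real T"
    using n T1 mult_mono[of "real L" n 1 "real T"] mult_mono[of 1 n "real l" "real T"]
      mult_mono[of 2 n 1 "real T"] by auto
  have "real (300 + 50 * l + 50 * L + 300 * (nat \<lceil>N\<rceil> + 1) * T + 50) = 350 + 50 * real l + 50 * real L + 300 * (n * real T)"
    by (simp add: n_def algebra_simps)
  also have "\<dots> \<le> 800 * (n * real T)" using nT by linarith
  also have "\<dots> \<le> 800 * ((3 * N) * (2 * (H * real l) * (S * A)))"
    using n T1 NL by (intro mult_left_mono mult_mono) auto
  \<comment> \<open>\<open>N\<close> carries \<open>R * R * H\<close>, that is 4 H^3 M^2, and the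
    sweeps supply the fourth H; 29491200 = 800 * 3 * 2 * 1536 * 4.\<close>
  also have "\<dots> = 29491200 * (real l * real L) * m"
    using eps_pos by (simp add: N R_def m_def field_simps power_numeral_reduce)
  also have "\<dots> \<le> 29491200 * ((10 * ln Y) * (16 * ln Y * \<omega>)) * m"
    using l_le L_le lnY SA H_pos by (intro mult_mono) (auto simp: m_def S_def A_def)
  also have "\<dots> = 4718592000 * (m * \<omega>) * ln Y ^ 2"
    by (simp add: power2_eq_square)
  also have "\<dots> \<le> 4718592000 * (S + m * \<omega>) * ln Y ^ 2"
    using S by (intro mult_right_mono) auto
  finally show ?thesis unfolding log main .
qed

end

theorem theorem4p21:
  shows "\<exists>prog :: com. \<forall>\<kappa> :: real. \<exists>(C :: real) (k :: nat).
    \<forall>(D :: dmdp) (M :: real) (\<epsilon> :: real) (\<delta> :: real) (orc :: sampler).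
      is_dmdp D M \<and> \<epsilon> > 0 \<and> 0 < \<delta> \<and> \<delta> < 1 \<and> sampling_oracle D \<kappa> orc \<longrightarrow>
      (let R = exec orc prog (init_state D M \<epsilon> \<delta>);
           B = C * main_bound D M \<epsilon> \<delta> * log_input D M \<epsilon> ^ k
       in measure (measure_spmf R)
            {s. eps_optimal D \<epsilon> (output_policy s) \<and> real (steps s) \<le> B} \<ge> 1 - \<delta> \<and>
          expected_time R \<le> ennreal B)"
proof (intro exI allI impI, elim conjE)
  fix \<kappa> :: real and D :: dmdp and M \<epsilon> \<delta> :: real and orc :: sampler
  assume D: "is_dmdp D M" and \<epsilon>: "0 < \<epsilon>" and \<delta>: "0 < \<delta>" "\<delta> < 1" and orc: "sampling_oracle D \<kappa> orc"
  interpret discounted_mdp D M by unfold_locales (fact D)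
  define s where "s = init_state D M \<epsilon> \<delta>"
  define p where "p = exec orc solver s"
  define B\<^sub>0 where "B\<^sub>0 = 4718592000 * main_bound D M \<epsilon> \<delta> * log_input D M \<epsilon> ^ 2"
  \<comment> \<open>The 1 pays for the steps, \<kappa> for the oracle. \<kappa> may be negative, and
    \<open>ennreal\<close> then makes it 0, whence the maximum.\<close>
  define B where "B = 4718592000 * (1 + max 0 \<kappa>) * main_bound D M \<epsilon> \<delta> * log_input D M \<epsilon> ^ 2"
  have B: "B = (1 + max 0 \<kappa>) * B\<^sub>0" by (simp add: B_def B\<^sub>0_def)
  have main: "1 \<le> main_bound D M \<epsilon> \<delta>"
    using nS_pos unfolding main_bound_def by (auto intro!: add_increasing2 mult_nonneg_nonneg divide_nonneg_nonneg)
  have "exp 1 \<le> 2 + real (nS D) + real (nA D) + M + 1 / (1 - \<gamma>) + 1 / \<epsilon>"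
    using exp_le nS_pos nA_pos M_pos H_ge_1 \<epsilon> by (simp add: H_def add_increasing2)
  then have "1 \<le> log_input D M \<epsilon>"
    unfolding log_input_def by (subst ln_ge_iff) (auto intro: less_le_trans[OF exp_gt_zero])
  then have "1 \<le> main_bound D M \<epsilon> \<delta> * log_input D M \<epsilon> ^ 2"
    using main mult_mono[of 1 "main_bound D M \<epsilon> \<delta>" 1 "log_input D M \<epsilon> ^ 2"] by simp
  then have B\<^sub>0: "50 \<le> B\<^sub>0" by (simp add: B\<^sub>0_def)
  define n where "n = nat \<lfloor>B\<^sub>0\<rfloor>"
  have n: "real n \<le> B\<^sub>0" "\<And>k. real k \<le> B\<^sub>0 \<Longrightarrow> k \<le> n"
    using B\<^sub>0 by (auto simp: n_def le_nat_floor)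
  have nB: "real n * (1 + max 0 \<kappa>) \<le> B" "real n \<le> B"
  proof -
    show 1: "real n * (1 + max 0 \<kappa>) \<le> B"
      unfolding B using n(1) by (subst mult.commute) (intro mult_left_mono, auto)
    have "real n * 1 \<le> real n * (1 + max 0 \<kappa>)" by (intro mult_left_mono) auto
    with 1 show "real n \<le> B" by simp
  qed
  \<comment> \<open>Used below once for the probability and once for the time. For \<epsilon> >= R
    no sample is drawn and the zero policy is returned, so the left-hand side is 0.\<close>
  have sol: "ewp p f \<le> c * ennreal \<delta> + b * (ennreal \<kappa> * of_nat n)"
    if f: "\<And>t. steps t \<le> n \<Longrightarrow> f t \<le> c * of_bool (\<not> eps_optimal D \<epsilon> (output_policy t)) + b * of_nat (orc_time t)"
    for f c b
  proof (cases "\<epsilon> < R")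
    case True
    interpret sampled_value_iteration D M \<epsilon> by unfold_locales (fact \<epsilon>, fact True)
    show ?thesis
      unfolding p_def s_def
      by (rule ewp_solver[OF orc \<delta> _ f]) (use n(2) solver_time[OF \<delta>] in \<open>auto simp: B\<^sub>0_def simp del: of_nat_add of_nat_mult\<close>)
  next
    case False
    have pol: "is_policy D (output_policy t)" if "imem t = imem s" for t
      using that nA_pos by (simp add: is_policy_def output_policy_def s_def init_state_def)
    have "50 \<le> n" using n(2)[of 50] B\<^sub>0 by simp
    then have "f t \<le> 0" if "steps t \<le> 50" "imem t = imem s" "orc_time t = 0" for t
      using f[of t] eps_optimal_trivial[of \<epsilon>, OF _ pol[OF that(2)]] False that by simp
    moreover have "\<not> bval (RLess (rvar ''eps'')
        (RMul (RMul (rlit 2) (RDiv (rlit 1) (RSub (rlit 1) (rvar ''gamma'')))) (rvar ''M''))) s"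
      using False by (simp add: s_def init_state_def R_def H_def)
    ultimately have "ewp p f \<le> 0"
      unfolding p_def solver_def ewp_exec by (simp del: One_nat_def le_zero_eq add: s_def init_state_def)
    then show ?thesis by simp
  qed
  have "ewp p (\<lambda>t. of_bool (\<not> (eps_optimal D \<epsilon> (output_policy t) \<and> real (steps t) \<le> B))) \<le> ennreal \<delta>"
  proof -
    have "ewp p (\<lambda>t. of_bool (\<not> (eps_optimal D \<epsilon> (output_policy t) \<and> real (steps t) \<le> B)))
      \<le> 1 * ennreal \<delta> + 0 * (ennreal \<kappa> * of_nat n)"
      using nB(2) by (intro sol) auto
    then show ?thesis by simp
  qed
  then have "1 - \<delta> \<le> measure (measure_spmf p) {t. eps_optimal D \<epsilon> (output_policy t) \<and> real (steps t) \<le> B}"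
    using \<delta> by (intro measure_ge_of_ewp) auto
  moreover have "expected_time p \<le> ennreal B"
  proof -
    \<comment> \<open>The infinite charge beyond \<open>n\<close> steps makes
      \<open>steps + orc_time\<close> at most \<open>n + f\<close> on every state, while
      \<open>sol\<close> only asks about states within the budget.\<close>
    define f :: "state \<Rightarrow> ennreal" where "f t = (if steps t \<le> n then of_nat (orc_time t) else \<infinity>)" for t
    have "expected_time p = ewp p (\<lambda>t. of_nat (steps t + orc_time t))"
      by (simp only: expected_time_def ewp_def)
    also have "\<dots> \<le> ewp p (\<lambda>t. of_nat n + f t)"
      by (intro ewp_mono) (auto simp: f_def intro!: add_mono)
    also have "\<dots> \<le> of_nat n + ewp p f" by (rule ewp_const_add)
    also have "\<dots> \<le> of_nat n + (0 * ennreal \<delta> + 1 * (ennreal \<kappa> * of_nat n))"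
      by (intro add_left_mono sol) (simp add: f_def)
    also have "\<dots> = ennreal (real n * (1 + max 0 \<kappa>))"
    proof -
      have "ennreal (real n * (1 + max 0 \<kappa>)) = ennreal (real n + max 0 \<kappa> * real n)"
        by (simp add: distrib_left mult.commute)
      also have "\<dots> = ennreal (real n) + ennreal (max 0 \<kappa>) * ennreal (real n)"
        by (subst ennreal_plus) (simp_all add: ennreal_mult)
      also have "ennreal (max 0 \<kappa>) = ennreal \<kappa>" by (simp add: max_def ennreal_neg)
      finally show ?thesis by (simp add: ennreal_of_nat_eq_real_of_nat)
    qed
    also have "\<dots> \<le> ennreal B" using nB(1) by (rule ennreal_leI)
    finally show ?thesis .
  qed
  ultimately show "let R = exec orc solver (init_state D M \<epsilon> \<delta>);
           B = 4718592000 * (1 + max 0 \<kappa>) * main_bound D M \<epsilon> \<delta> * log_input D M \<epsilon> ^ 2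
       in 1 - \<delta> \<le> measure (measure_spmf R)
            {s. eps_optimal D \<epsilon> (output_policy s) \<and> real (steps s) \<le> B} \<and>
          expected_time R \<le> ennreal B"
    unfolding Let_def p_def s_def B_def by simp
qed

end
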